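(* For each $\epsilon>0$, $$\mathbb{P}_{n,\alpha}\left[\sup_{t\in[0,1]}\left|\frac{K_{b_t(n)}}{n/\alpha(n)}-t\right|>\epsilon\right]\to0\qquad\text{as }n\to\infty .$$
   Context: Fix $a_1,a_2\in(0,1)$ and a sequence $\alpha=(\alpha(n))_{n\in\mathbb{N}}$ with $n^{a_1}\le\alpha(n)\le n^{a_2}$. $S_{n,\alpha}$ is the set of permutations of $\{1,\dots,n\}$ all of whose cycles have length at most $\alpha(n)$; $\mathbb{P}_{n,\alpha}$ is the uniform probability measure on $S_{n,\alpha}$. $C_j=C_j(\sigma)$ is the number of cycles of length $j$ in $\sigma$, and $K_m=\sum_{j=1}^mC_j$ (sum over integers $1\le j\le m$) is the number of cycles of length at most $m$. For $0\le t\le1$, $$b_t(n):=\max\left\{\alpha(n)+\left\lfloor\log(t)\frac{\alpha(n)}{\log\left(n/\alpha(n)\right)}\right\rfloor,\,0\right\},$$ with $b_0(n)=0$ (i.e. $\log 0=-\infty$). *)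

theory Defs
  imports "HOL-Probability.Probability" "HOL-Combinatorics.Combinatorics"
begin

text \<open>
  A permutation of \<open>{1..n}\<close> is a function \<open>\<sigma>\<close> with \<open>\<sigma> permutes {1..n}\<close>. Its cycles are
  represented by their supports, the orbits of the points of \<open>{1..n}\<close>; fixed points are
  cycles of length 1. The bound \<open>\<alpha> n\<close> on the cycle lengths may be any real number.
\<close>

definition perm_cycles :: "nat \<Rightarrow> (nat \<Rightarrow> nat) \<Rightarrow> nat set set" where
  "perm_cycles n \<sigma> = orbit \<sigma> ` {1..n}"

definition short_perms :: "(nat \<Rightarrow> real) \<Rightarrow> nat \<Rightarrow> (nat \<Rightarrow> nat) set" where
  "short_perms \<alpha> n =
     {\<sigma>. \<sigma> permutes {1..n} \<and> (\<forall>c\<in>perm_cycles n \<sigma>. real (card c) \<le> \<alpha> n)}"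

definition cycle_count :: "nat \<Rightarrow> nat \<Rightarrow> (nat \<Rightarrow> nat) \<Rightarrow> nat" where
  "cycle_count n j \<sigma> = card {c \<in> perm_cycles n \<sigma>. card c = j}"

definition cum_cycle_count :: "nat \<Rightarrow> real \<Rightarrow> (nat \<Rightarrow> nat) \<Rightarrow> nat" where
  "cum_cycle_count n m \<sigma> = (\<Sum>j | 1 \<le> j \<and> real j \<le> m. cycle_count n j \<sigma>)"

text \<open>The case \<open>t = 0\<close> is separate because \<open>ln 0 = 0\<close> in HOL, whereas here \<open>log 0 = -\<infinity>\<close>.\<close>

definition cycle_threshold :: "(nat \<Rightarrow> real) \<Rightarrow> real \<Rightarrow> nat \<Rightarrow> real" where
  "cycle_threshold \<alpha> t n =
     (if t = 0 then 0
      else max (\<alpha> n + of_int \<lfloor>ln t * (\<alpha> n / ln (real n / \<alpha> n))\<rfloor>) 0)"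

text \<open>
  \<open>pmf_of_set\<close> is the uniform distribution on finite nonempty sets. Here the set is finite,
  and it contains the identity whenever \<open>\<alpha> n \<ge> 1\<close> or \<open>n = 0\<close>.
\<close>

definition short_perm_pmf :: "(nat \<Rightarrow> real) \<Rightarrow> nat \<Rightarrow> (nat \<Rightarrow> nat) pmf" where
  "short_perm_pmf \<alpha> n = pmf_of_set (short_perms \<alpha> n)"

end

theory Submission
  imports Defs "HOL-Real_Asymp.Real_Asymp"
begin

text \<open>
  Write \<open>p\<^sub>k\<close> for the proportion of permutations of a \<open>k\<close>-set all of whose cycles have length at
  most \<open>m\<close>, where \<open>m\<close> is the integer part of \<open>\<alpha>(n)\<close>, and let \<open>q\<^sub>j = p\<^bsub>n-j\<^esub> / p\<^sub>n\<close>. Everything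
  is read off from the sequence \<open>p\<close>.

  Moments. Deleting a cycle of length \<open>j\<close> leaves a permutation of the same kind on \<open>n - j\<close>
  points. Hence \<open>n p\<^sub>n = p\<^bsub>n-1\<^esub> + ... + p\<^bsub>n-m\<^esub>\<close>, the expected number of cycles of length \<open>j\<close> is
  \<open>q\<^sub>j / j\<close>, and the factorial second moments are given by the ratios \<open>p\<^bsub>n-i-j\<^esub> / (i j p\<^sub>n)\<close>.

  Log-concavity. The recurrence makes \<open>p\<close> log-concave (a case of a theorem of Bender and
  Canfield), so \<open>R\<^sub>k = p\<^sub>k / p\<^bsub>k+1\<^esub>\<close> is nondecreasing in \<open>k\<close>. This has two consequences. First,
  the numbers of cycles of different lengths are negatively correlated, and \<open>E[K(K-1)] \<le> (E K)\<^sup>2\<close>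
  for the number \<open>K\<close> of cycles of length at most any given bound; so by Chebyshev's inequality
  \<open>K\<close> is close to its mean as soon as the mean is large. Second, consecutive quotients
  \<open>q\<^bsub>j+1\<^esub> / q\<^sub>j\<close> with \<open>j < m\<close> all lie between \<open>s = R\<^bsub>n-m\<^esub>\<close> and \<open>r = R\<^bsub>n-1\<^esub>\<close>. Comparing the
  recurrence at \<open>n - m + 1\<close> and at \<open>n + m\<close> with geometric sums shows that both \<open>m ln s\<close> and
  \<open>m ln r\<close> are asymptotic to \<open>L = ln (n/\<alpha>)\<close>.

  The mean. By the recurrence, \<open>q\<^sub>1 + ... + q\<^sub>m = n\<close>. Shifting the index by \<open>d\<close> multiplies \<open>q\<^sub>j\<close>
  by a factor between \<open>s\<^sup>d\<close> and \<open>r\<^sup>d\<close>.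
  With \<open>d\<close> close to \<open>- ln t \<alpha> / L\<close> both tend to \<open>1/t\<close>, so \<open>q\<^sub>1 + ... + q\<^bsub>m-d\<^esub>\<close> is asymptotic to
  \<open>t n\<close>. Since the \<open>q\<^sub>j\<close> concentrate near \<open>j = m\<close>, the weights \<open>1/j\<close> can be replaced by
  \<open>1/m\<close>, and the expected number of cycles of length at most \<open>m - d\<close>, or equivalently at most
  \<open>b\<^sub>t(n)\<close>, is asymptotic to \<open>t n / \<alpha>\<close>.

  Uniformity. The count is monotone in \<open>t\<close> and the limit \<open>t\<close> is continuous, so convergence
  on a finite grid of values of \<open>t\<close> controls the supremum.
\<close>

section \<open>Removing a cycle from a permutation\<close>

abbreviation cycles_on :: "'a set \<Rightarrow> ('a \<Rightarrow> 'a) \<Rightarrow> 'a set set" where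
  "cycles_on A \<sigma> \<equiv> orbit \<sigma> ` A"

definition full_cycles :: "'a set \<Rightarrow> ('a \<Rightarrow> 'a) set" where
  "full_cycles c = {\<rho>. \<rho> permutes c \<and> cyclic_on \<rho> c}"

lemma cyclic_on_cycle:
  assumes "finite A" "\<sigma> permutes A" "c \<in> cycles_on A \<sigma>"
  shows "cyclic_on \<sigma> c" "c \<subseteq> A" "c \<noteq> {}"
proof -
  obtain x where x: "x \<in> A" "c = orbit \<sigma> x" using assms(3) by auto
  show "cyclic_on \<sigma> c" using cyclic_on_orbit[OF assms(2,1)] x by simp
  show "c \<subseteq> A" using permutes_orbit_subset[OF assms(2)] x by simp
  show "c \<noteq> {}" using orbit_nonempty[of \<sigma> x] x by simp
qed

lemma cycles_on_compose:
  assumes fin: "finite A" and c: "c \<subseteq> A" "c \<noteq> {}"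
    and \<rho>: "\<rho> \<in> full_cycles c" and \<tau>: "\<tau> permutes (A - c)"
  shows "\<rho> \<circ> \<tau> permutes A"
    and "cycles_on A (\<rho> \<circ> \<tau>) = insert c (cycles_on (A - c) \<tau>)"
    and "c \<notin> cycles_on (A - c) \<tau>"
proof -
  have \<rho>p: "\<rho> permutes c" and \<rho>c: "cyclic_on \<rho> c" using \<rho> by (auto simp: full_cycles_def)
  show "\<rho> \<circ> \<tau> permutes A"
    using permutes_compose[OF permutes_subset[OF \<tau>, of A] permutes_subset[OF \<rho>p c(1)]] by auto
  have "cyclic_on (\<rho> \<circ> \<tau>) c"
    using permutes_comp_preserves_cyclic1[OF \<tau> \<rho>c, of c] by auto
  then have 1: "orbit (\<rho> \<circ> \<tau>) x = c" if "x \<in> c" for x using that by (rule orbit_cyclic_eq3)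
  have 2: "orbit (\<rho> \<circ> \<tau>) x = orbit \<tau> x" if x: "x \<in> A - c" for x
  proof -
    have "x \<in> orbit \<tau> x"
      using \<tau> fin by (intro permutation_self_in_orbit) (auto simp: permutation_permutes)
    moreover have "(\<rho> \<circ> \<tau>) s = \<tau> s" if "s \<in> orbit \<tau> x" for s
    proof -
      have "\<tau> s \<in> A - c"
        using orbit.step[OF that] permutes_orbit_subset[OF \<tau> x] by blast
      then show ?thesis using \<rho>p by (simp add: permutes_def)
    qed
    ultimately show ?thesis by (rule orbit_cong)
  qed
  have "cycles_on A (\<rho> \<circ> \<tau>) = cycles_on c (\<rho> \<circ> \<tau>) \<union> cycles_on (A - c) (\<rho> \<circ> \<tau>)"
    using c(1) by blast
  also have "cycles_on c (\<rho> \<circ> \<tau>) = {c}" using 1 c(2) by auto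
  also have "cycles_on (A - c) (\<rho> \<circ> \<tau>) = cycles_on (A - c) \<tau>" using 2 by auto
  finally show "cycles_on A (\<rho> \<circ> \<tau>) = insert c (cycles_on (A - c) \<tau>)" by (simp only: Un_insert_left Un_empty_left)
  show "c \<notin> cycles_on (A - c) \<tau>"
    using permutes_orbit_subset[OF \<tau>] c(2) by fastforce
qed

text \<open>
  A permutation with a prescribed cycle \<open>c\<close> splits into a cyclic permutation of \<open>c\<close> and an
  arbitrary permutation of the complement; the inverse of composition is restriction.
\<close>

lemma bij_betw_remove_cycle:
  assumes fin: "finite A" and c: "c \<subseteq> A" "c \<noteq> {}"
  shows "bij_betw (\<lambda>(\<rho>, \<tau>). \<rho> \<circ> \<tau>) (full_cycles c \<times> {\<tau>. \<tau> permutes (A - c)})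
           {\<sigma>. \<sigma> permutes A \<and> c \<in> cycles_on A \<sigma>}"
proof (rule bij_betwI[where g = "\<lambda>\<sigma>. (perm_restrict \<sigma> c, perm_restrict \<sigma> (A - c))"])
  show "(\<lambda>(\<rho>, \<tau>). \<rho> \<circ> \<tau>) \<in> full_cycles c \<times> {\<tau>. \<tau> permutes (A - c)}
          \<rightarrow> {\<sigma>. \<sigma> permutes A \<and> c \<in> cycles_on A \<sigma>}"
    using cycles_on_compose[OF fin c] by auto
next
  have *: "perm_restrict \<sigma> c permutes c \<and> cyclic_on (perm_restrict \<sigma> c) c
      \<and> perm_restrict \<sigma> (A - c) permutes (A - c)
      \<and> perm_restrict \<sigma> c \<circ> perm_restrict \<sigma> (A - c) = \<sigma>"
    if "\<sigma> permutes A" "c \<in> cycles_on A \<sigma>" for \<sigma>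
  proof -
    have cyc: "cyclic_on \<sigma> c" using cyclic_on_cycle[OF fin that] by simp
    have 1: "perm_restrict \<sigma> (A - c) permutes (A - c)"
      using perm_restrict_diff_cyclic[OF that(1) cyc] .
    have "bij_betw \<sigma> c c"
    proof -
      have "inj_on \<sigma> c" using that(1) by (meson inj_on_subset permutes_inj top_greatest)
      moreover have "\<sigma> ` c \<subseteq> c" using cyclic_on_inI[OF cyc] by auto
      moreover have "finite c" using finite_cyclic_on[OF cyc] .
      ultimately show ?thesis
        by (simp add: bij_betw_def endo_inj_surj)
    qed
    then have "bij_betw (perm_restrict \<sigma> c) c c"
      by (subst bij_betw_cong[where g = \<sigma>]) (auto simp: perm_restrict_simps)
    then have 2: "perm_restrict \<sigma> c permutes c"
      by (rule bij_imp_permutes) (simp add: perm_restrict_simps)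
    have "perm_restrict \<sigma> c \<circ> perm_restrict \<sigma> (A - c) = perm_restrict \<sigma> (c \<union> (A - c))"
      using perm_restrict_union[OF 2 1] by auto
    also have "c \<union> (A - c) = A" using c by auto
    also have "perm_restrict \<sigma> A = \<sigma>" using that(1) by (rule perm_restrict_id)
    finally show ?thesis using 1 2 cyc by (simp only: cyclic_on_perm_restrict simp_thms)
  qed
  show "(\<lambda>\<sigma>. (perm_restrict \<sigma> c, perm_restrict \<sigma> (A - c)))
     \<in> {\<sigma>. \<sigma> permutes A \<and> c \<in> cycles_on A \<sigma>} \<rightarrow> full_cycles c \<times> {\<tau>. \<tau> permutes (A - c)}"
    using * by (auto simp: full_cycles_def)
  show "(case (perm_restrict \<sigma> c, perm_restrict \<sigma> (A - c)) of (\<rho>, \<tau>) \<Rightarrow> \<rho> \<circ> \<tau>) = \<sigma>"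
    if "\<sigma> \<in> {\<sigma>. \<sigma> permutes A \<and> c \<in> cycles_on A \<sigma>}" for \<sigma>
    using * that by (simp del: comp_apply)
  fix x assume "x \<in> full_cycles c \<times> {\<tau>. \<tau> permutes (A - c)}"
  then obtain \<rho> \<tau> where x: "x = (\<rho>, \<tau>)" and \<rho>: "\<rho> permutes c" and \<tau>: "\<tau> permutes (A - c)"
    by (auto simp: full_cycles_def)
  have "perm_restrict (\<rho> \<circ> \<tau>) c = \<rho>"
    using \<rho> \<tau> by (auto simp: fun_eq_iff perm_restrict_def permutes_def)
  moreover have "perm_restrict (\<rho> \<circ> \<tau>) (A - c) = \<tau>"
  proof
    fix y
    show "perm_restrict (\<rho> \<circ> \<tau>) (A - c) y = \<tau> y"
    proof (cases "y \<in> A - c")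
      case True
      then have "\<tau> y \<in> A - c" using permutes_in_image[OF \<tau>] by blast
      then show ?thesis using True \<rho> by (auto simp: perm_restrict_def permutes_def)
    next
      case False
      then show ?thesis using \<tau> unfolding perm_restrict_def permutes_def by auto
    qed
  qed
  ultimately show "(perm_restrict (case x of (\<rho>, \<tau>) \<Rightarrow> \<rho> \<circ> \<tau>) c,
          perm_restrict (case x of (\<rho>, \<tau>) \<Rightarrow> \<rho> \<circ> \<tau>) (A - c)) = x"
    by (simp add: x)
qed

text \<open>
  All statistics used below depend on a permutation only through its set of cycles. For such a
  statistic \<open>G\<close>, the cyclic permutation of the prescribed cycle contributes just a
  multiplicity.
\<close>

lemma sum_with_cycle:
  fixes G :: "'a set set \<Rightarrow> real"
  assumes fin: "finite A" and c: "c \<subseteq> A" "c \<noteq> {}"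
  shows "(\<Sum>\<sigma> | \<sigma> permutes A \<and> c \<in> cycles_on A \<sigma>. G (cycles_on A \<sigma>))
       = real (card (full_cycles c))
         * (\<Sum>\<tau> | \<tau> permutes (A - c). G (insert c (cycles_on (A - c) \<tau>)))"
proof -
  have "(\<Sum>\<sigma> | \<sigma> permutes A \<and> c \<in> cycles_on A \<sigma>. G (cycles_on A \<sigma>))
      = (\<Sum>(\<rho>, \<tau>) \<in> full_cycles c \<times> {\<tau>. \<tau> permutes (A - c)}. G (cycles_on A (\<rho> \<circ> \<tau>)))"
    by (subst sum.reindex_bij_betw[OF bij_betw_remove_cycle[OF fin c], symmetric])
       (simp add: case_prod_unfold)
  also have "\<dots> = (\<Sum>(\<rho>, \<tau>) \<in> full_cycles c \<times> {\<tau>. \<tau> permutes (A - c)}.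
                     G (insert c (cycles_on (A - c) \<tau>)))"
    by (intro sum.cong refl) (auto simp: cycles_on_compose(2)[OF fin c])
  also have "\<dots> = (\<Sum>\<rho>\<in>full_cycles c. \<Sum>\<tau> | \<tau> permutes (A - c). G (insert c (cycles_on (A - c) \<tau>)))"
    by (rule sum.cartesian_product[symmetric])
  finally show ?thesis by simp
qed

text \<open>
  The permutations are classified by the cycle that contains a fixed point \<open>a\<close>. This is the
  source of the recurrence for the proportion of permutations with short cycles.
\<close>

lemma sum_perms_by_cycle_of:
  fixes G :: "'a set set \<Rightarrow> real"
  assumes fin: "finite A" and a: "a \<in> A"
  shows "(\<Sum>\<sigma> | \<sigma> permutes A. G (cycles_on A \<sigma>))
       = (\<Sum>c | c \<subseteq> A \<and> a \<in> c. real (card (full_cycles c))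
           * (\<Sum>\<tau> | \<tau> permutes (A - c). G (insert c (cycles_on (A - c) \<tau>))))"
proof -
  have fP: "finite {\<sigma>. \<sigma> permutes A}" using fin by (rule finite_permutations)
  have fC: "finite {c. c \<subseteq> A \<and> a \<in> c}" using fin by simp
  have "orbit \<sigma> a \<subseteq> A" "a \<in> orbit \<sigma> a" if "\<sigma> permutes A" for \<sigma>
    using permutes_orbit_subset[OF that a] permutation_self_in_orbit[of \<sigma> a] that fin
    by (auto simp: permutation_permutes)
  then have "(\<Sum>\<sigma> | \<sigma> permutes A. G (cycles_on A \<sigma>))
      = (\<Sum>c | c \<subseteq> A \<and> a \<in> c. \<Sum>\<sigma> | \<sigma> \<in> {\<sigma>. \<sigma> permutes A} \<and> orbit \<sigma> a = c. G (cycles_on A \<sigma>))"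
    by (intro sum.group[OF fP fC, symmetric]) auto
  also have "\<dots> = (\<Sum>c | c \<subseteq> A \<and> a \<in> c. \<Sum>\<sigma> | \<sigma> permutes A \<and> c \<in> cycles_on A \<sigma>. G (cycles_on A \<sigma>))"
  proof (intro sum.cong refl)
    fix c assume "c \<in> {c. c \<subseteq> A \<and> a \<in> c}"
    then have ac: "a \<in> c" by simp
    have "orbit \<sigma> a = c \<longleftrightarrow> c \<in> cycles_on A \<sigma>" if "\<sigma> permutes A" for \<sigma>
    proof
      show "c \<in> cycles_on A \<sigma>" if "orbit \<sigma> a = c" using that a by (rule image_eqI[OF sym])
      show "orbit \<sigma> a = c" if "c \<in> cycles_on A \<sigma>"
        using orbit_cyclic_eq3[OF cyclic_on_cycle(1)[OF fin \<open>\<sigma> permutes A\<close> that] ac] .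
    qed
    then show "{\<sigma> \<in> {\<sigma>. \<sigma> permutes A}. orbit \<sigma> a = c} = {\<sigma>. \<sigma> permutes A \<and> c \<in> cycles_on A \<sigma>}"
      by auto
  qed
  also have "\<dots> = (\<Sum>c | c \<subseteq> A \<and> a \<in> c. real (card (full_cycles c))
           * (\<Sum>\<tau> | \<tau> permutes (A - c). G (insert c (cycles_on (A - c) \<tau>))))"
    using fin by (intro sum.cong refl sum_with_cycle) auto
  finally show ?thesis .
qed

lemma sum_subsets_by_card:
  fixes f :: "nat \<Rightarrow> real"
  assumes "finite A"
  shows "(\<Sum>c | c \<subseteq> A. f (card c)) = (\<Sum>j\<le>card A. real (card A choose j) * f j)"
proof -
  have "(\<Sum>c | c \<subseteq> A. f (card c)) = (\<Sum>j\<le>card A. \<Sum>c | c \<in> {c. c \<subseteq> A} \<and> card c = j. f (card c))"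
    using assms by (intro sum.group[symmetric]) (auto intro: card_mono)
  also have "\<dots> = (\<Sum>j\<le>card A. real (card A choose j) * f j)"
    using n_subsets[OF assms] by (intro sum.cong refl) simp
  finally show ?thesis .
qed

lemma sum_subsets_containing_by_card:
  fixes f :: "nat \<Rightarrow> real"
  assumes "finite A" "a \<in> A"
  shows "(\<Sum>c | c \<subseteq> A \<and> a \<in> c. f (card c))
       = (\<Sum>j<card A. real ((card A - 1) choose j) * f (Suc j))"
proof -
  have fin: "finite (A - {a})" using assms by simp
  have bij: "bij_betw (insert a) {c. c \<subseteq> A - {a}} {c. c \<subseteq> A \<and> a \<in> c}"
    using assms(2) by (intro bij_betwI[where g = "\<lambda>c. c - {a}"]) auto
  have "(\<Sum>c | c \<subseteq> A \<and> a \<in> c. f (card c)) = (\<Sum>c | c \<subseteq> A - {a}. f (card (insert a c)))"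
    by (rule sum.reindex_bij_betw[OF bij, symmetric])
  also have "\<dots> = (\<Sum>c | c \<subseteq> A - {a}. f (Suc (card c)))"
  proof (intro sum.cong refl)
    fix c assume "c \<in> {c. c \<subseteq> A - {a}}"
    then have "finite c" "a \<notin> c" using fin finite_subset by auto
    then show "f (card (insert a c)) = f (Suc (card c))" by simp
  qed
  also have "\<dots> = (\<Sum>j\<le>card (A - {a}). real (card (A - {a}) choose j) * f (Suc j))"
    by (rule sum_subsets_by_card[OF fin, where f = "\<lambda>j. f (Suc j)"])
  also have "\<dots> = (\<Sum>j<card A. real ((card A - 1) choose j) * f (Suc j))"
    using assms card_gt_0_iff[of A] by (intro sum.cong) auto
  finally show ?thesis .
qed

text \<open>
  Counting all \<open>n!\<close> permutations by the cycle of a fixed point determines the number \<open>z\<^sub>n\<close> of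
  cyclic ones: by induction every class of a proper subset of size \<open>j\<close> contributes
  \<open>(j-1)! (n-j)!\<close>, which sums to \<open>(n-1)!\<close> for each \<open>j < n\<close>. What remains of \<open>n!\<close> for \<open>z\<^sub>n\<close> is \<open>(n-1)!\<close>.
\<close>

lemma card_full_cycles:
  assumes "finite c" "c \<noteq> {}"
  shows "real (card (full_cycles c)) = fact (card c - 1)"
  using assms
proof (induction "card c" arbitrary: c rule: less_induct)
  case less
  obtain a where a: "a \<in> c" using less.prems by auto
  let ?n = "card c"
  have n: "?n > 0" using less.prems by (simp add: card_gt_0_iff)
  define h :: "nat \<Rightarrow> real" where "h j = fact (j - 1) * fact (?n - j)" for j
  have cP: "real (card {\<tau>. \<tau> permutes (c - b)}) = fact (?n - card b)" if "b \<subseteq> c" for b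
    using card_permutations[of "c - b" "?n - card b"] less.prems that
    by (simp add: card_Diff_subset finite_subset)
  \<comment> \<open>the class of \<open>c\<close> itself is split off, being the only one not covered by the induction hypothesis\<close>
  have "(\<Sum>\<sigma> | \<sigma> permutes c. 1) = (\<Sum>b | b \<subseteq> c \<and> a \<in> b. real (card (full_cycles b))
           * (\<Sum>\<tau> | \<tau> permutes (c - b). 1))"
    by (rule sum_perms_by_cycle_of[OF less.prems(1) a, where G = "\<lambda>_. 1"])
  then have "real (card {\<sigma>. \<sigma> permutes c})
      = (\<Sum>b | b \<subseteq> c \<and> a \<in> b. real (card (full_cycles b)) * fact (?n - card b))"
    using cP by simp
  also have "\<dots> = real (card (full_cycles c)) * fact (?n - card c)
      + (\<Sum>b \<in> {b. b \<subseteq> c \<and> a \<in> b} - {c}. real (card (full_cycles b)) * fact (?n - card b))"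
    using less.prems a by (intro sum.remove) auto
  also have "(\<Sum>b \<in> {b. b \<subseteq> c \<and> a \<in> b} - {c}. real (card (full_cycles b)) * fact (?n - card b))
      = (\<Sum>b \<in> {b. b \<subseteq> c \<and> a \<in> b} - {c}. h (card b))"
  proof (intro sum.cong refl)
    fix b assume b: "b \<in> {b. b \<subseteq> c \<and> a \<in> b} - {c}"
    then have "card b < ?n" using less.prems by (intro psubset_card_mono) auto
    then show "real (card (full_cycles b)) * fact (?n - card b) = h (card b)"
      using less.hyps[of b] b less.prems finite_subset by (auto simp: h_def)
  qed
  also have "\<dots> = (\<Sum>b | b \<subseteq> c \<and> a \<in> b. h (card b)) - h ?n"
    using less.prems a by (subst sum_diff1) auto
  also have "(\<Sum>b | b \<subseteq> c \<and> a \<in> b. h (card b)) = (\<Sum>j<?n. real ((?n - 1) choose j) * h (Suc j))"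
    by (rule sum_subsets_containing_by_card[OF less.prems(1) a, where f = h])
  also have "\<dots> = (\<Sum>j<?n. fact (?n - 1))"
  proof (intro sum.cong refl)
    fix j assume "j \<in> {..<?n}"
    then have j: "j \<le> ?n - 1" by auto
    have "real ((?n - 1) choose j) * h (Suc j) = real ((fact j * fact (?n - 1 - j) * ((?n - 1) choose j)))"
      using n by (simp add: h_def)
    also have "\<dots> = real (fact (?n - 1))" using binomial_fact_lemma[OF j] by metis
    finally show "real ((?n - 1) choose j) * h (Suc j) = fact (?n - 1)" by simp
  qed
  also have "\<dots> = fact ?n" using n by (simp add: fact_reduce)
  finally show ?case using less.prems card_permutations[OF refl less.prems(1)] by (simp add: h_def)
qed

definition short_perms_on :: "nat \<Rightarrow> 'a set \<Rightarrow> ('a \<Rightarrow> 'a) set" where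
  "short_perms_on m A = {\<sigma>. \<sigma> permutes A \<and> (\<forall>c\<in>cycles_on A \<sigma>. card c \<le> m)}"

lemma finite_short_perms_on: "finite A \<Longrightarrow> finite (short_perms_on m A)"
  unfolding short_perms_on_def by (rule finite_subset[OF _ finite_permutations[of A]]) auto

text \<open>
  This is \<open>p\<^sub>n\<close>, the coefficient of \<open>z\<^sup>n\<close> in \<open>exp (\<Sum>j=1..m. z\<^sup>j/j)\<close>. A definition by recurrence
  depends on sizes only; \<open>card_short_perms_on\<close> identifies it with the proportion of short
  permutations of every set of size \<open>n\<close>.
\<close>

function short_fraction :: "nat \<Rightarrow> nat \<Rightarrow> real" where
  "short_fraction m n =
     (if n = 0 then 1 else (\<Sum>j\<in>{1..min m n}. short_fraction m (n - j)) / real n)"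
  by pat_completeness auto
termination by (relation "Wellfounded.measure snd") auto

declare short_fraction.simps [simp del]

lemma short_fraction_0 [simp]: "short_fraction m 0 = 1"
  by (subst short_fraction.simps) simp

lemma short_fraction_rec:
  "real n * short_fraction m n = (\<Sum>j | j \<in> {1..m} \<and> j \<le> n. short_fraction m (n - j))"
proof -
  have "{j. j \<in> {1..m} \<and> j \<le> n} = {1..min m n}" by auto
  moreover have "real n * short_fraction m n = (\<Sum>j\<in>{1..min m n}. short_fraction m (n - j))"
  proof (cases "n = 0")
    case False
    then show ?thesis by (subst short_fraction.simps) simp
  qed simp
  ultimately show ?thesis by simp
qed

lemma sum_short_perms_on:
  fixes g :: "('a \<Rightarrow> 'a) \<Rightarrow> real"
  assumes "finite A"
  shows "sum g (short_perms_on m A)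
     = (\<Sum>\<sigma> | \<sigma> permutes A. of_bool (\<forall>c\<in>cycles_on A \<sigma>. card c \<le> m) * g \<sigma>)"
proof -
  have "short_perms_on m A = {\<sigma> \<in> {\<sigma>. \<sigma> permutes A}. \<forall>c\<in>cycles_on A \<sigma>. card c \<le> m}"
    by (simp add: short_perms_on_def)
  then have "sum g (short_perms_on m A)
      = (\<Sum>\<sigma>\<in>{\<sigma>. \<sigma> permutes A}. if \<forall>c\<in>cycles_on A \<sigma>. card c \<le> m then g \<sigma> else 0)"
    using sum.inter_filter[OF finite_permutations[OF assms]] by (simp only:)
  also have "\<dots> = (\<Sum>\<sigma> | \<sigma> permutes A. of_bool (\<forall>c\<in>cycles_on A \<sigma>. card c \<le> m) * g \<sigma>)"
    by (intro sum.cong refl) simp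
  finally show ?thesis .
qed

text \<open>
  Both sides satisfy the recurrence obtained from the cycle of a fixed point.
\<close>

lemma card_short_perms_on:
  assumes "finite A"
  shows "real (card (short_perms_on m A)) = fact (card A) * short_fraction m (card A)"
  using assms
proof (induction "card A" arbitrary: A rule: less_induct)
  case less
  show ?case
  proof (cases "A = {}")
    case True
    then have "short_perms_on m A = {id}" by (auto simp: short_perms_on_def)
    then show ?thesis using True by simp
  next
    case False
    then obtain a where a: "a \<in> A" by auto
    let ?n = "card A"
    have n: "?n > 0" using less.prems False by (simp add: card_gt_0_iff)
    define h :: "nat \<Rightarrow> real" where
      "h j = fact (j - 1) * (of_bool (j \<le> m) * (fact (?n - j) * short_fraction m (?n - j)))" for j
    have "real (card (short_perms_on m A))
        = (\<Sum>\<sigma> | \<sigma> permutes A. of_bool (\<forall>c\<in>cycles_on A \<sigma>. card c \<le> m))"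
      using sum_short_perms_on[OF less.prems, where g = "\<lambda>_. 1"] by simp
    also have "\<dots> = (\<Sum>c | c \<subseteq> A \<and> a \<in> c. real (card (full_cycles c))
           * (\<Sum>\<tau> | \<tau> permutes (A - c). of_bool (\<forall>c\<in>insert c (cycles_on (A - c) \<tau>). card c \<le> m)))"
      by (rule sum_perms_by_cycle_of[OF less.prems a,
            where G = "\<lambda>X. of_bool (\<forall>c\<in>X. card c \<le> m)"])
    also have "\<dots> = (\<Sum>c | c \<subseteq> A \<and> a \<in> c. h (card c))"
    proof (intro sum.cong refl)
      fix c assume c: "c \<in> {c. c \<subseteq> A \<and> a \<in> c}"
      then have fc: "finite c" "c \<noteq> {}" using less.prems finite_subset by auto
      have cd: "card (A - c) = ?n - card c" "card (A - c) < ?n"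
        using c fc less.prems n by (auto simp: card_Diff_subset card_gt_0_iff)
      have "(\<Sum>\<tau> | \<tau> permutes (A - c). of_bool (\<forall>c\<in>insert c (cycles_on (A - c) \<tau>). card c \<le> m))
          = of_bool (card c \<le> m) * real (card (short_perms_on m (A - c)))"
        using sum_short_perms_on[of "A - c" "\<lambda>_. 1" m] less.prems by simp
      also have "\<dots> = of_bool (card c \<le> m) * (fact (?n - card c) * short_fraction m (?n - card c))"
        using less.hyps[OF cd(2)] less.prems cd(1) by simp
      finally show "real (card (full_cycles c))
           * (\<Sum>\<tau> | \<tau> permutes (A - c). of_bool (\<forall>c\<in>insert c (cycles_on (A - c) \<tau>). card c \<le> m))
           = h (card c)"
        using card_full_cycles[OF fc] by (simp add: h_def)
    qed
    also have "\<dots> = (\<Sum>j<?n. real ((?n - 1) choose j) * h (Suc j))"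
      by (rule sum_subsets_containing_by_card[OF less.prems a, where f = h])
    also have "\<dots> = (\<Sum>j<?n. of_bool (Suc j \<le> m) * (fact (?n - 1) * short_fraction m (?n - Suc j)))"
    proof (intro sum.cong refl)
      fix j assume "j \<in> {..<?n}"
      then have j: "j \<le> ?n - 1" by auto
      have "real ((?n - 1) choose j) * h (Suc j)
          = real (fact j * fact (?n - 1 - j) * ((?n - 1) choose j))
              * (of_bool (Suc j \<le> m) * short_fraction m (?n - Suc j))"
        using n by (simp add: h_def)
      then show "real ((?n - 1) choose j) * h (Suc j)
          = of_bool (Suc j \<le> m) * (fact (?n - 1) * short_fraction m (?n - Suc j))"
        unfolding binomial_fact_lemma[OF j] by simp
    qed
    also have "\<dots> = (\<Sum>j\<in>{1..?n}. of_bool (j \<le> m) * (fact (?n - 1) * short_fraction m (?n - j)))"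
      by (rule sum.reindex_bij_witness[where i = "\<lambda>j. j - 1" and j = Suc]) auto
    also have "\<dots> = (\<Sum>j | j \<in> {1..m} \<and> j \<le> ?n. fact (?n - 1) * short_fraction m (?n - j))"
      by (rule sum.mono_neutral_cong_right) auto
    also have "\<dots> = fact (?n - 1) * (real ?n * short_fraction m ?n)"
      unfolding short_fraction_rec by (rule sum_distrib_left[symmetric])
    also have "\<dots> = fact ?n * short_fraction m ?n" using n by (simp add: fact_reduce)
    finally show ?thesis .
  qed
qed

text \<open>
  For permutations of \<open>{1..n}\<close> this agrees with the cumulative cycle count of the theorem
  (\<open>cum_cycle_count_eq\<close>). Here the underlying set is arbitrary, so that a cycle can be removed.
\<close>

definition cycles_upto :: "nat \<Rightarrow> 'a set \<Rightarrow> ('a \<Rightarrow> 'a) \<Rightarrow> nat" where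
  "cycles_upto b A \<sigma> = card {c \<in> cycles_on A \<sigma>. card c \<le> b}"

text \<open>
  Exchange the sum over permutations with the sum over their cycles and remove the chosen cycle.
  The hypothesis \<open>b \<le> m\<close> makes the removed cycle itself admissible, so the condition on the
  lengths passes to the remaining permutation unchanged. With \<open>H = 1\<close> this yields the first moment, and
  with \<open>H\<close> one less than the number of counted cycles the second factorial moment.
\<close>

lemma sum_over_short_cycles:
  fixes H :: "'a set set \<Rightarrow> real"
  assumes fin: "finite A" and b: "b \<le> m"
  shows "(\<Sum>\<sigma>\<in>short_perms_on m A. \<Sum>c | c \<in> cycles_on A \<sigma> \<and> card c \<le> b. H (cycles_on A \<sigma>))
       = (\<Sum>c | c \<subseteq> A \<and> card c \<in> {1..b}. fact (card c - 1)
           * (\<Sum>\<tau>\<in>short_perms_on m (A - c). H (insert c (cycles_on (A - c) \<tau>))))"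
proof -
  let ?P = "{\<sigma>. \<sigma> permutes A}" and ?C = "{c. c \<subseteq> A \<and> card c \<in> {1..b}}"
  define G where "G X = of_bool (\<forall>c\<in>X. card c \<le> m) * H X" for X
  have fP: "finite ?P" using fin by (rule finite_permutations)
  have fC: "finite ?C" using fin by simp
  have "(\<Sum>\<sigma>\<in>short_perms_on m A. \<Sum>c | c \<in> cycles_on A \<sigma> \<and> card c \<le> b. H (cycles_on A \<sigma>))
      = (\<Sum>\<sigma>\<in>?P. \<Sum>c | c \<in> cycles_on A \<sigma> \<and> card c \<le> b. G (cycles_on A \<sigma>))"
    by (subst sum_short_perms_on[OF fin]) (simp add: G_def mult.left_commute)
  also have "\<dots> = (\<Sum>\<sigma>\<in>?P. \<Sum>c | c \<in> ?C \<and> c \<in> cycles_on A \<sigma>. G (cycles_on A \<sigma>))"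
  proof (intro sum.cong refl)
    fix \<sigma> assume "\<sigma> \<in> ?P"
    then have "c \<subseteq> A \<and> 1 \<le> card c" if "c \<in> cycles_on A \<sigma>" for c
      using cyclic_on_cycle[OF fin _ that] fin
      by (metis One_nat_def Suc_leI card_gt_0_iff finite_subset mem_Collect_eq)
    then show "{c. c \<in> cycles_on A \<sigma> \<and> card c \<le> b} = {c. c \<in> ?C \<and> c \<in> cycles_on A \<sigma>}"
      by auto
  qed
  also have "\<dots> = (\<Sum>c\<in>?C. \<Sum>\<sigma> | \<sigma> \<in> ?P \<and> c \<in> cycles_on A \<sigma>. G (cycles_on A \<sigma>))"
    by (rule sum.swap_restrict[OF fP fC])
  also have "\<dots> = (\<Sum>c\<in>?C. fact (card c - 1)
           * (\<Sum>\<tau>\<in>short_perms_on m (A - c). H (insert c (cycles_on (A - c) \<tau>))))"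
  proof (intro sum.cong refl)
    fix c assume "c \<in> ?C"
    then have c: "c \<subseteq> A" "c \<noteq> {}" "finite c" "card c \<le> m"
      using b fin finite_subset by auto
    have "(\<Sum>\<sigma> | \<sigma> \<in> ?P \<and> c \<in> cycles_on A \<sigma>. G (cycles_on A \<sigma>))
        = real (card (full_cycles c))
         * (\<Sum>\<tau> | \<tau> permutes (A - c). G (insert c (cycles_on (A - c) \<tau>)))"
      using sum_with_cycle[OF fin c(1,2)] by simp
    then show "(\<Sum>\<sigma> | \<sigma> \<in> ?P \<and> c \<in> cycles_on A \<sigma>. G (cycles_on A \<sigma>)) = fact (card c - 1)
           * (\<Sum>\<tau>\<in>short_perms_on m (A - c). H (insert c (cycles_on (A - c) \<tau>)))"
      using fin c card_full_cycles[OF c(3,2)] by (simp add: G_def sum_short_perms_on)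
  qed
  finally show ?thesis .
qed

text \<open>
  There are \<open>n! / (j! (n-j)!)\<close> subsets of size \<open>j\<close>, so the factorials cancel up to \<open>n! / j\<close>.
\<close>

lemma sum_subsets_times_fact:
  fixes f :: "nat \<Rightarrow> real"
  assumes "finite A"
  shows "(\<Sum>c | c \<subseteq> A \<and> card c \<in> {1..b}. fact (card c - 1) * (fact (card A - card c) * f (card c)))
       = fact (card A) * (\<Sum>j | j \<in> {1..b} \<and> j \<le> card A. f j / real j)"
proof -
  let ?n = "card A"
  have "(\<Sum>c | c \<subseteq> A \<and> card c \<in> {1..b}. fact (card c - 1) * (fact (?n - card c) * f (card c)))
      = (\<Sum>c | c \<subseteq> A. of_bool (card c \<in> {1..b}) * (fact (card c - 1) * (fact (?n - card c) * f (card c))))"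
    using assms by (intro sum.mono_neutral_cong_left) auto
  also have "\<dots> = (\<Sum>j\<le>?n. real (?n choose j)
        * (of_bool (j \<in> {1..b}) * (fact (j - 1) * (fact (?n - j) * f j))))"
    by (rule sum_subsets_by_card[OF assms,
          where f = "\<lambda>j. of_bool (j \<in> {1..b}) * (fact (j - 1) * (fact (?n - j) * f j))"])
  also have "\<dots> = (\<Sum>j\<le>?n. of_bool (j \<in> {1..b}) * (fact ?n * (f j / real j)))"
  proof (intro sum.cong refl)
    fix j assume "j \<in> {..?n}"
    then have j: "j \<le> ?n" by simp
    show "real (?n choose j) * (of_bool (j \<in> {1..b}) * (fact (j - 1) * (fact (?n - j) * f j)))
        = of_bool (j \<in> {1..b}) * (fact ?n * (f j / real j))"
    proof (cases "j \<in> {1..b}")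
      case True
      then have "fact j = real j * fact (j - 1)" by (simp add: fact_reduce)
      moreover have "fact ?n = fact j * fact (?n - j) * real (?n choose j)"
        using binomial_fact_lemma[OF j] by (metis of_nat_fact of_nat_mult)
      ultimately show ?thesis using True by simp
    next
      case False
      then show ?thesis by (simp only: of_bool_eq(1) mult_zero_left mult_zero_right)
    qed
  qed
  also have "\<dots> = (\<Sum>j | j \<in> {1..b} \<and> j \<le> ?n. fact ?n * (f j / real j))"
    by (rule sum.mono_neutral_cong_right) auto
  finally show ?thesis by (simp add: sum_distrib_left)
qed

lemma sum_cycles_upto:
  assumes fin: "finite A" and b: "b \<le> m"
  shows "(\<Sum>\<sigma>\<in>short_perms_on m A. real (cycles_upto b A \<sigma>))
       = fact (card A) * (\<Sum>j | j \<in> {1..b} \<and> j \<le> card A. short_fraction m (card A - j) / real j)"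
proof -
  have "(\<Sum>\<sigma>\<in>short_perms_on m A. real (cycles_upto b A \<sigma>))
      = (\<Sum>\<sigma>\<in>short_perms_on m A. \<Sum>c | c \<in> cycles_on A \<sigma> \<and> card c \<le> b. 1)"
    by (simp add: cycles_upto_def)
  also have "\<dots> = (\<Sum>c | c \<subseteq> A \<and> card c \<in> {1..b}. fact (card c - 1)
           * (\<Sum>\<tau>\<in>short_perms_on m (A - c). 1))"
    by (rule sum_over_short_cycles[OF fin b, where H = "\<lambda>_. 1"])
  also have "\<dots> = (\<Sum>c | c \<subseteq> A \<and> card c \<in> {1..b}. fact (card c - 1)
           * (fact (card A - card c) * short_fraction m (card A - card c)))"
    using fin by (intro sum.cong refl)
      (auto simp: card_short_perms_on card_Diff_subset finite_subset)
  also have "\<dots> = fact (card A) * (\<Sum>j | j \<in> {1..b} \<and> j \<le> card A. short_fraction m (card A - j) / real j)"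
    by (rule sum_subsets_times_fact[OF fin, where f = "\<lambda>j. short_fraction m (card A - j)"])
  finally show ?thesis .
qed

text \<open>
  An ordered pair of distinct cycles is a cycle \<open>c\<close> together with a cycle of what remains after
  \<open>c\<close> has been removed, so the first moment formula applies once more on the complement of \<open>c\<close>.
\<close>

lemma sum_cycles_upto_pairs:
  assumes fin: "finite A" and b: "b \<le> m"
  shows "(\<Sum>\<sigma>\<in>short_perms_on m A. real (cycles_upto b A \<sigma>) * (real (cycles_upto b A \<sigma>) - 1))
       = fact (card A) * (\<Sum>j | j \<in> {1..b} \<and> j \<le> card A.
           (\<Sum>i | i \<in> {1..b} \<and> i \<le> card A - j. short_fraction m (card A - j - i) / real i) / real j)"
proof -
  define H :: "'a set set \<Rightarrow> real" where "H X = real (card {c \<in> X. card c \<le> b}) - 1" for X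
  have "(\<Sum>\<sigma>\<in>short_perms_on m A. real (cycles_upto b A \<sigma>) * (real (cycles_upto b A \<sigma>) - 1))
      = (\<Sum>\<sigma>\<in>short_perms_on m A. \<Sum>c | c \<in> cycles_on A \<sigma> \<and> card c \<le> b. H (cycles_on A \<sigma>))"
    by (simp only: cycles_upto_def H_def sum_constant)
  also have "\<dots> = (\<Sum>c | c \<subseteq> A \<and> card c \<in> {1..b}. fact (card c - 1)
           * (\<Sum>\<tau>\<in>short_perms_on m (A - c). H (insert c (cycles_on (A - c) \<tau>))))"
    by (rule sum_over_short_cycles[OF fin b, where H = H])
  also have "\<dots> = (\<Sum>c | c \<subseteq> A \<and> card c \<in> {1..b}. fact (card c - 1)
           * (fact (card A - card c) * (\<Sum>i | i \<in> {1..b} \<and> i \<le> card A - card c.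
                short_fraction m (card A - card c - i) / real i)))"
  proof (intro sum.cong refl)
    fix c assume c: "c \<in> {c. c \<subseteq> A \<and> card c \<in> {1..b}}"
    then have fc: "finite c" "c \<noteq> {}" using fin finite_subset by auto
    then have cd: "card (A - c) = card A - card c" using c by (simp add: card_Diff_subset)
    have "H (insert c (cycles_on (A - c) \<tau>)) = real (cycles_upto b (A - c) \<tau>)"
      if "\<tau> \<in> short_perms_on m (A - c)" for \<tau>
    proof -
      have "\<tau> permutes (A - c)" using that by (simp add: short_perms_on_def)
      then have "c \<notin> cycles_on (A - c) \<tau>"
        using permutes_orbit_subset[of \<tau> "A - c"] fc by fastforce
      moreover have "{d \<in> insert c (cycles_on (A - c) \<tau>). card d \<le> b}
          = insert c {d \<in> cycles_on (A - c) \<tau>. card d \<le> b}"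
        using c by auto
      ultimately show ?thesis using fin by (simp add: H_def cycles_upto_def)
    qed
    then show "fact (card c - 1) * (\<Sum>\<tau>\<in>short_perms_on m (A - c). H (insert c (cycles_on (A - c) \<tau>)))
      = fact (card c - 1) * (fact (card A - card c) * (\<Sum>i | i \<in> {1..b} \<and> i \<le> card A - card c.
                short_fraction m (card A - card c - i) / real i))"
      using sum_cycles_upto[of "A - c" b m] fin b cd by simp
  qed
  also have "\<dots> = fact (card A) * (\<Sum>j | j \<in> {1..b} \<and> j \<le> card A.
           (\<Sum>i | i \<in> {1..b} \<and> i \<le> card A - j. short_fraction m (card A - j - i) / real i) / real j)"
    by (rule sum_subsets_times_fact[OF fin, where f = "\<lambda>j.
          \<Sum>i | i \<in> {1..b} \<and> i \<le> card A - j. short_fraction m (card A - j - i) / real i"])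
  finally show ?thesis .
qed

section \<open>Log-concavity and the first two moments\<close>

lemma short_fraction_pos:
  assumes "m \<ge> 1"
  shows "short_fraction m n > 0"
proof (induction n rule: less_induct)
  case (less n)
  show ?case
  proof (cases "n = 0")
    case False
    have "0 < (\<Sum>j | j \<in> {1..m} \<and> j \<le> n. short_fraction m (n - j))"
      using assms False less by (intro sum_pos) (auto intro: exI[of _ 1])
    then have "0 < real n * short_fraction m n" by (simp only: short_fraction_rec)
    then show ?thesis using False by (simp add: zero_less_mult_iff)
  qed simp
qed

lemma short_fraction_1: "m \<ge> 1 \<Longrightarrow> short_fraction m (Suc 0) = 1"
proof -
  assume "m \<ge> 1"
  then have "{j. j \<in> {1..m} \<and> j \<le> Suc 0} = {1}" by auto
  then show ?thesis using short_fraction_rec[of "Suc 0" m] by simp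
qed

text \<open>
  With \<open>X\<^sub>i = [i \<le> m]\<close>, the recurrence exhibits both \<open>(n+1) p\<^bsub>n+1\<^esub>\<close> and \<open>(n+1) p\<^sub>n\<close> as
  convolutions of \<open>X\<close> with \<open>p\<^sub>0, ..., p\<^sub>n\<close>: the first without, the second with the term \<open>X\<^sub>0\<close>.
\<close>

lemma short_fraction_conv_strict:
  "real (Suc n) * short_fraction m (Suc n) = (\<Sum>k\<le>n. of_bool (Suc n - k \<le> m) * short_fraction m k)"
proof -
  have "real (Suc n) * short_fraction m (Suc n)
      = (\<Sum>j | j \<in> {1..m} \<and> j \<le> Suc n. short_fraction m (Suc n - j))"
    by (rule short_fraction_rec)
  also have "\<dots> = (\<Sum>k | k \<le> n \<and> Suc n - k \<le> m. short_fraction m k)"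
    by (rule sum.reindex_bij_witness[where i = "\<lambda>k. Suc n - k" and j = "\<lambda>j. Suc n - j"]) auto
  also have "\<dots> = (\<Sum>k\<le>n. of_bool (Suc n - k \<le> m) * short_fraction m k)"
    by (rule sum.mono_neutral_cong_left) auto
  finally show ?thesis .
qed

lemma short_fraction_conv:
  "real (Suc n) * short_fraction m n = (\<Sum>k\<le>n. of_bool (n - k \<le> m) * short_fraction m k)"
proof (cases n)
  case (Suc N)
  have "(\<Sum>k\<le>n. of_bool (n - k \<le> m) * short_fraction m k)
      = (\<Sum>k\<le>N. of_bool (Suc N - k \<le> m) * short_fraction m k) + short_fraction m n"
    by (simp add: Suc)
  then show ?thesis
    using short_fraction_conv_strict[of N m] Suc by (simp add: algebra_simps)
qed simp

text \<open>
  The difference of the two sides is, by the Cauchy-Binet identity, half the sum over all pairs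
  \<open>k, l\<close> of products of two antisymmetric \<open>2\<times>2\<close> minors. By hypothesis the two minors never have
  opposite signs.
\<close>

lemma sum_product_le_of_minors:
  fixes u v a b :: "'i::linorder \<Rightarrow> real"
  assumes uv: "\<And>k l. k \<in> I \<Longrightarrow> l \<in> I \<Longrightarrow> k < l \<Longrightarrow> u l * v k \<le> u k * v l"
    and ab: "\<And>k l. k \<in> I \<Longrightarrow> l \<in> I \<Longrightarrow> k < l \<Longrightarrow> a l * b k \<le> a k * b l"
  shows "(\<Sum>k\<in>I. u k * b k) * (\<Sum>l\<in>I. v l * a l) \<le> (\<Sum>k\<in>I. u k * a k) * (\<Sum>l\<in>I. v l * b l)"
proof -
  let ?D = "\<lambda>k l. (u k * v l - u l * v k) * (a k * b l - a l * b k)"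
  have "0 \<le> (\<Sum>k\<in>I. \<Sum>l\<in>I. ?D k l)"
  proof (intro sum_nonneg)
    fix k l assume "k \<in> I" "l \<in> I"
    then show "0 \<le> ?D k l"
      using uv[of k l] ab[of k l] uv[of l k] ab[of l k]
      by (cases k l rule: linorder_cases) (auto intro: mult_nonneg_nonneg mult_nonpos_nonpos)
  qed
  also have "(\<Sum>k\<in>I. \<Sum>l\<in>I. ?D k l)
      = (\<Sum>k\<in>I. \<Sum>l\<in>I. (u k * a k) * (v l * b l)) - (\<Sum>k\<in>I. \<Sum>l\<in>I. (u k * b k) * (v l * a l))
      - ((\<Sum>k\<in>I. \<Sum>l\<in>I. (u l * b l) * (v k * a k)) - (\<Sum>k\<in>I. \<Sum>l\<in>I. (u l * a l) * (v k * b k)))"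
    unfolding sum_subtractf[symmetric] by (intro sum.cong refl) (simp add: algebra_simps)
  also have "\<dots> = 2 * ((\<Sum>k\<in>I. u k * a k) * (\<Sum>l\<in>I. v l * b l)
                    - (\<Sum>k\<in>I. u k * b k) * (\<Sum>l\<in>I. v l * a l))"
    by (simp add: sum_product sum.swap[of "\<lambda>k l. u l * b l * (v k * a k)"]
        sum.swap[of "\<lambda>k l. u l * a l * (v k * b k)"])
  finally show ?thesis by simp
qed

text \<open>
  Let \<open>N = n + 1\<close>. By the Cauchy-Binet inequality for the rows \<open>X\<^bsub>N-k\<^esub>\<close>, \<open>X\<^bsub>N+1-k\<^esub>\<close> and the
  columns \<open>p\<^sub>k\<close>, \<open>p\<^bsub>k-1\<^esub>\<close> with \<open>k \<le> N\<close>, and by the convolution identities,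
  \<open>N p\<^bsub>N-1\<^esub> (N+1) p\<^bsub>N+1\<^esub> \<le> (N+1) p\<^sub>N N p\<^sub>N\<close>. Only minors of \<open>p\<close> with indices at most \<open>N\<close>
  enter; their signs are given by the induction hypothesis. Truncating the sums at \<open>N\<close> and
  keeping the term \<open>X\<^sub>0\<close> in only one of the two rows is what makes the prefactors on the two
  sides equal.
\<close>

lemma short_fraction_log_concave:
  assumes m: "m \<ge> 1"
  shows "short_fraction m n * short_fraction m (Suc (Suc n)) \<le> (short_fraction m (Suc n))\<^sup>2"
proof (induction n rule: less_induct)
  case (less n)
  let ?p = "short_fraction m" and ?N = "Suc n"
  \<comment> \<open>\<open>p\<close> shifted by one place, with the convention \<open>p\<^bsub>-1\<^esub> = 0\<close>\<close>
  define b where "b k = (case k of 0 \<Rightarrow> 0 | Suc i \<Rightarrow> ?p i)" for k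
  have b_simps [simp]: "b 0 = 0" "b (Suc i) = ?p i" for i by (simp_all add: b_def)
  have pos: "?p k > 0" for k using short_fraction_pos[OF m] .
  have step: "b k / ?p k \<le> b (Suc k) / ?p (Suc k)" if "Suc k \<le> ?N" for k
  proof (cases k)
    case 0
    then show ?thesis using pos[of 0] pos[of "Suc 0"] by simp
  next
    case (Suc i)
    then have "?p i * ?p (Suc (Suc i)) \<le> ?p (Suc i) * ?p (Suc i)"
      using less[of i] that by (simp add: power2_eq_square)
    then show ?thesis using pos[of "Suc i"] pos[of "Suc (Suc i)"] Suc
      by (simp add: divide_simps mult.commute)
  qed
  have "(\<Sum>k\<le>?N. of_bool (?N - k \<le> m) * b k) * (\<Sum>k\<le>?N. of_bool (Suc ?N - k \<le> m) * ?p k)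
     \<le> (\<Sum>k\<le>?N. of_bool (?N - k \<le> m) * ?p k) * (\<Sum>k\<le>?N. of_bool (Suc ?N - k \<le> m) * b k)"
  proof (rule sum_product_le_of_minors)
    fix k l assume kl: "k \<in> {..?N}" "l \<in> {..?N}" "k < l"
    then show "of_bool (?N - l \<le> m) * of_bool (Suc ?N - k \<le> m)
        \<le> (of_bool (?N - k \<le> m) * of_bool (Suc ?N - l \<le> m) :: real)"
      by auto
    have "b k / ?p k \<le> b (k + d) / ?p (k + d)" if "k + d \<le> ?N" for d
      using that
    proof (induction d)
      case (Suc d)
      then show ?case using step[of "k + d"] by simp
    qed simp
    from this[of "l - k"] have "b k / ?p k \<le> b l / ?p l" using kl by simp
    then show "?p l * b k \<le> ?p k * b l"
      using pos[of k] pos[of l] by (simp add: divide_simps mult.commute)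
  qed
  also have "(\<Sum>k\<le>?N. of_bool (?N - k \<le> m) * b k) = real ?N * ?p n"
    unfolding short_fraction_conv by (subst sum.atMost_Suc_shift) simp
  also have "(\<Sum>k\<le>?N. of_bool (Suc ?N - k \<le> m) * b k) = real ?N * ?p ?N"
    unfolding short_fraction_conv_strict by (subst sum.atMost_Suc_shift) simp
  also have "(\<Sum>k\<le>?N. of_bool (?N - k \<le> m) * ?p k) = real (Suc ?N) * ?p ?N"
    by (rule short_fraction_conv[symmetric])
  also have "(\<Sum>k\<le>?N. of_bool (Suc ?N - k \<le> m) * ?p k) = real (Suc ?N) * ?p (Suc ?N)"
    by (rule short_fraction_conv_strict[symmetric])
  finally have "(real ?N * real (Suc ?N)) * (?p n * ?p (Suc ?N))
      \<le> (real ?N * real (Suc ?N)) * (?p ?N)\<^sup>2"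
    by (simp only: power2_eq_square mult_ac)
  then show ?case by (subst (asm) mult_le_cancel_left_pos) auto
qed

definition step_ratio :: "nat \<Rightarrow> nat \<Rightarrow> real" where
  "step_ratio m k = short_fraction m k / short_fraction m (Suc k)"

lemma mono_step_ratio:
  assumes "m \<ge> 1"
  shows "mono (step_ratio m)"
proof (rule incseq_SucI)
  fix k
  show "step_ratio m k \<le> step_ratio m (Suc k)"
    using short_fraction_log_concave[OF assms, of k] short_fraction_pos[OF assms]
    by (simp add: step_ratio_def divide_simps power2_eq_square mult.commute)
qed

lemma step_ratio_ge_1:
  assumes "m \<ge> 1"
  shows "step_ratio m k \<ge> 1"
proof -
  have "step_ratio m 0 = 1" by (simp add: step_ratio_def short_fraction_1[OF assms])
  then show ?thesis using monoD[OF mono_step_ratio[OF assms], of 0 k] by simp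
qed

lemma short_fraction_Suc:
  assumes "m \<ge> 1"
  shows "short_fraction m k = step_ratio m k * short_fraction m (Suc k)"
  using short_fraction_pos[OF assms, of "Suc k"] by (simp add: step_ratio_def)

lemma short_fraction_ge_power:
  assumes "m \<ge> 1" "lo \<le> k"
  shows "step_ratio m lo ^ d * short_fraction m (k + d) \<le> short_fraction m k"
proof (induction d)
  case (Suc d)
  have "step_ratio m lo ^ Suc d * short_fraction m (k + Suc d)
      = step_ratio m lo ^ d * (step_ratio m lo * short_fraction m (Suc (k + d)))"
    by simp
  also have "\<dots> \<le> step_ratio m lo ^ d * (step_ratio m (k + d) * short_fraction m (Suc (k + d)))"
    using step_ratio_ge_1[OF assms(1), of lo] short_fraction_pos[OF assms(1)] assms(2)
      monoD[OF mono_step_ratio[OF assms(1)], of lo "k + d"]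
    by (intro mult_left_mono mult_right_mono) (auto intro: less_imp_le)
  also have "\<dots> = step_ratio m lo ^ d * short_fraction m (k + d)"
    by (simp add: short_fraction_Suc[OF assms(1), of "k + d"])
  finally show ?case using Suc by simp
qed simp

lemma short_fraction_le_power:
  assumes "m \<ge> 1" "k + d \<le> Suc hi"
  shows "short_fraction m k \<le> step_ratio m hi ^ d * short_fraction m (k + d)"
  using assms(2)
proof (induction d)
  case (Suc d)
  have "short_fraction m k \<le> step_ratio m hi ^ d * short_fraction m (k + d)"
    using Suc by simp
  also have "\<dots> = step_ratio m hi ^ d * (step_ratio m (k + d) * short_fraction m (Suc (k + d)))"
    by (simp add: short_fraction_Suc[OF assms(1), of "k + d"])
  also have "\<dots> \<le> step_ratio m hi ^ d * (step_ratio m hi * short_fraction m (Suc (k + d)))"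
    using step_ratio_ge_1[OF assms(1), of hi] short_fraction_pos[OF assms(1)] Suc.prems
      monoD[OF mono_step_ratio[OF assms(1)], of "k + d" hi]
    by (intro mult_left_mono mult_right_mono) (auto intro: less_imp_le)
  finally show ?case by (simp add: mult_ac)
qed simp

lemma short_fraction_quotient_mono:
  assumes "m \<ge> 1"
  shows "short_fraction m a / short_fraction m (a + i) \<le> short_fraction m (a + j) / short_fraction m (a + j + i)"
proof (induction i)
  case 0
  show ?case using short_fraction_pos[OF assms, of a] short_fraction_pos[OF assms, of "a + j"] by simp
next
  case (Suc i)
  have split: "short_fraction m c / short_fraction m (c + Suc i)
      = short_fraction m c / short_fraction m (c + i) * step_ratio m (c + i)" for c
    using short_fraction_pos[OF assms, of "c + i"] by (simp add: step_ratio_def)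
  show ?case unfolding split
    using Suc monoD[OF mono_step_ratio[OF assms], of "a + i" "a + j + i"]
      step_ratio_ge_1[OF assms, of "a + i"]
      short_fraction_pos[OF assms, of "a + j"] short_fraction_pos[OF assms, of "a + j + i"]
    by (intro mult_mono) auto
qed

text \<open>
  Negative correlation in terms of \<open>p\<close>: this is \<open>q\<^bsub>i+j\<^esub> \<le> q\<^sub>i q\<^sub>j\<close> for \<open>q\<^sub>j = p\<^bsub>n-j\<^esub> / p\<^sub>n\<close>.
\<close>

lemma short_fraction_two_cycles:
  assumes "m \<ge> 1" "i + j \<le> n"
  shows "short_fraction m (n - j - i) * short_fraction m n \<le> short_fraction m (n - j) * short_fraction m (n - i)"
proof -
  have "n - j - i + i = n - j" "n - j - i + j = n - i" "n - i + i = n" using assms(2) by auto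
  then show ?thesis
    using short_fraction_quotient_mono[OF assms(1), of "n - j - i" i j]
      short_fraction_pos[OF assms(1), of n] short_fraction_pos[OF assms(1), of "n - j"]
    by (simp add: divide_simps mult.commute)
qed

text \<open>
  For \<open>b \<le> m \<le> n\<close> this is the expected number of cycles of length at most \<open>b\<close> in a uniform
  permutation of \<open>n\<close> points with all cycles of length at most \<open>m\<close>.
\<close>

definition mean_cycles :: "nat \<Rightarrow> nat \<Rightarrow> nat \<Rightarrow> real" where
  "mean_cycles m n b = (\<Sum>j=1..b. short_fraction m (n - j) / real j) / short_fraction m n"

lemma sum_cycles_upto_eq_mean:
  assumes m: "m \<ge> 1" and fin: "finite A" and b: "b \<le> m" "b \<le> card A"
  shows "(\<Sum>\<sigma>\<in>short_perms_on m A. real (cycles_upto b A \<sigma>))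
       = real (card (short_perms_on m A)) * mean_cycles m (card A) b"
proof -
  have "{j. j \<in> {1..b} \<and> j \<le> card A} = {1..b}" using b by auto
  then show ?thesis
    using sum_cycles_upto[OF fin b(1)] card_short_perms_on[OF fin, of m]
      short_fraction_pos[OF m, of "card A"] by (simp add: mean_cycles_def)
qed

lemma sum_cycles_upto_pairs_le:
  assumes m: "m \<ge> 1" and fin: "finite A" and b: "b \<le> m" "b \<le> card A"
  shows "(\<Sum>\<sigma>\<in>short_perms_on m A. real (cycles_upto b A \<sigma>) * (real (cycles_upto b A \<sigma>) - 1))
       \<le> real (card (short_perms_on m A)) * (mean_cycles m (card A) b)\<^sup>2"
proof -
  let ?n = "card A" and ?p = "short_fraction m"
  have pos: "?p k > 0" for k using short_fraction_pos[OF m] .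
  have inner: "(\<Sum>i | i \<in> {1..b} \<and> i \<le> ?n - j. ?p (?n - j - i) / real i)
       \<le> ?p (?n - j) * mean_cycles m ?n b" if j: "j \<in> {1..b}" for j
  proof -
    have "(\<Sum>i | i \<in> {1..b} \<and> i \<le> ?n - j. ?p (?n - j - i) / real i)
        \<le> (\<Sum>i | i \<in> {1..b} \<and> i \<le> ?n - j. ?p (?n - j) * (?p (?n - i) / real i / ?p ?n))"
    proof (intro sum_mono)
      fix i assume i: "i \<in> {i. i \<in> {1..b} \<and> i \<le> ?n - j}"
      then have "?p (?n - j - i) * ?p ?n \<le> ?p (?n - j) * ?p (?n - i)"
        using j b by (intro short_fraction_two_cycles[OF m]) auto
      then show "?p (?n - j - i) / real i \<le> ?p (?n - j) * (?p (?n - i) / real i / ?p ?n)"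
        using i pos[of ?n] by (simp add: field_simps)
    qed
    also have "\<dots> \<le> (\<Sum>i\<in>{1..b}. ?p (?n - j) * (?p (?n - i) / real i / ?p ?n))"
      by (intro sum_mono2)
        (auto intro!: mult_nonneg_nonneg divide_nonneg_nonneg less_imp_le[OF pos])
    also have "\<dots> = ?p (?n - j) * mean_cycles m ?n b"
      by (simp add: mean_cycles_def sum_divide_distrib sum_distrib_left)
    finally show ?thesis .
  qed
  have set_eq: "{j. j \<in> {1..b} \<and> j \<le> ?n} = {1..b}" using b by auto
  have "(\<Sum>\<sigma>\<in>short_perms_on m A. real (cycles_upto b A \<sigma>) * (real (cycles_upto b A \<sigma>) - 1))
     = fact ?n * (\<Sum>j\<in>{1..b}. (\<Sum>i | i \<in> {1..b} \<and> i \<le> ?n - j. ?p (?n - j - i) / real i) / real j)"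
    using sum_cycles_upto_pairs[OF fin b(1)] unfolding set_eq .
  also have "\<dots> \<le> fact ?n * (\<Sum>j\<in>{1..b}. ?p (?n - j) * mean_cycles m ?n b / real j)"
    using inner by (intro mult_left_mono sum_mono divide_right_mono) auto
  also have "(\<Sum>j\<in>{1..b}. ?p (?n - j) * mean_cycles m ?n b / real j)
      = (\<Sum>j\<in>{1..b}. ?p (?n - j) / real j) * mean_cycles m ?n b"
    by (simp add: sum_distrib_right)
  also have "(\<Sum>j\<in>{1..b}. ?p (?n - j) / real j) = ?p ?n * mean_cycles m ?n b"
    using pos[of ?n] by (simp add: mean_cycles_def)
  finally show ?thesis
    using card_short_perms_on[OF fin, of m] by (simp add: power2_eq_square mult_ac)
qed

text \<open>
  Since \<open>E[K(K-1)] \<le> \<mu>\<^sup>2\<close>, the mean square distance of \<open>K\<close> from any \<open>x\<close> is at most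
  \<open>(\<mu> - x)\<^sup>2 + \<mu>\<close>.
\<close>

lemma sum_sq_deviation_le:
  assumes m: "m \<ge> 1" and fin: "finite A" and b: "b \<le> m" "b \<le> card A"
  shows "(\<Sum>\<sigma>\<in>short_perms_on m A. (real (cycles_upto b A \<sigma>) - x)\<^sup>2)
       \<le> real (card (short_perms_on m A))
         * ((mean_cycles m (card A) b - x)\<^sup>2 + mean_cycles m (card A) b)"
proof -
  let ?S = "short_perms_on m A" and ?K = "\<lambda>\<sigma>. real (cycles_upto b A \<sigma>)"
    and ?\<mu> = "mean_cycles m (card A) b"
  have "(\<Sum>\<sigma>\<in>?S. (?K \<sigma> - x)\<^sup>2)
      = (\<Sum>\<sigma>\<in>?S. ?K \<sigma> * (?K \<sigma> - 1)) + (1 - 2 * x) * (\<Sum>\<sigma>\<in>?S. ?K \<sigma>) + real (card ?S) * x\<^sup>2"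
  proof -
    have "(?K \<sigma> - x)\<^sup>2 = ?K \<sigma> * (?K \<sigma> - 1) + (1 - 2 * x) * ?K \<sigma> + x\<^sup>2" for \<sigma>
      by (simp add: power2_eq_square algebra_simps)
    then show ?thesis by (simp add: sum.distrib sum_distrib_left)
  qed
  also have "\<dots> \<le> real (card ?S) * ?\<mu>\<^sup>2 + (1 - 2 * x) * (real (card ?S) * ?\<mu>) + real (card ?S) * x\<^sup>2"
    using sum_cycles_upto_pairs_le[OF assms] sum_cycles_upto_eq_mean[OF assms] by simp
  also have "\<dots> = real (card ?S) * ((?\<mu> - x)\<^sup>2 + ?\<mu>)"
    by (simp add: power2_eq_square algebra_simps)
  finally show ?thesis .
qed

lemma prob_cycles_upto_deviation_le:
  assumes m: "m \<ge> 1" and fin: "finite A" and b: "b \<le> m" "b \<le> card A" and e: "e > 0"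
  shows "measure_pmf.prob (pmf_of_set (short_perms_on m A)) {\<sigma>. \<bar>real (cycles_upto b A \<sigma>) - x\<bar> > e}
       \<le> ((mean_cycles m (card A) b - x)\<^sup>2 + mean_cycles m (card A) b) / e\<^sup>2"
proof -
  let ?S = "short_perms_on m A" and ?K = "\<lambda>\<sigma>. real (cycles_upto b A \<sigma>)"
    and ?\<mu> = "mean_cycles m (card A) b"
  let ?B = "{\<sigma>. \<bar>?K \<sigma> - x\<bar> > e}"
  have fS: "finite ?S" using fin by (rule finite_short_perms_on)
  have cS: "real (card ?S) > 0"
    using card_short_perms_on[OF fin, of m] short_fraction_pos[OF m] by simp
  then have S: "?S \<noteq> {}" by auto
  have "real (card (?S \<inter> ?B)) * e\<^sup>2 = (\<Sum>\<sigma>\<in>?S \<inter> ?B. e\<^sup>2)" by simp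
  also have "\<dots> \<le> (\<Sum>\<sigma>\<in>?S \<inter> ?B. (?K \<sigma> - x)\<^sup>2)"
    using e by (intro sum_mono) (auto intro!: abs_le_square_iff[THEN iffD1])
  also have "\<dots> \<le> (\<Sum>\<sigma>\<in>?S. (?K \<sigma> - x)\<^sup>2)"
    using fS by (intro sum_mono2) auto
  also have "\<dots> \<le> real (card ?S) * ((?\<mu> - x)\<^sup>2 + ?\<mu>)"
    by (rule sum_sq_deviation_le[OF m fin b])
  finally have "real (card (?S \<inter> ?B)) / real (card ?S) \<le> ((?\<mu> - x)\<^sup>2 + ?\<mu>) / e\<^sup>2"
    using cS e by (simp add: field_simps)
  then show ?thesis using measure_pmf_of_set[OF S fS] by simp
qed

section \<open>Bounds for the mean by geometric comparison\<close>

text \<open>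
  This is \<open>q\<^sub>1 + ... + q\<^sub>b\<close>; for \<open>b \<le> m \<le> n\<close> it is \<open>n\<close> times the probability that the cycle of a
  given point has length at most \<open>b\<close>.
\<close>

definition head_mass :: "nat \<Rightarrow> nat \<Rightarrow> nat \<Rightarrow> real" where
  "head_mass m n b = (\<Sum>j=1..b. short_fraction m (n - j)) / short_fraction m n"

lemma head_mass_nonneg: "m \<ge> 1 \<Longrightarrow> head_mass m n b \<ge> 0"
  by (simp add: head_mass_def sum_nonneg less_imp_le short_fraction_pos)

lemma head_mass_total:
  assumes "m \<ge> 1" "m \<le> n"
  shows "head_mass m n m = real n"
proof -
  have "{j. j \<in> {1..m} \<and> j \<le> n} = {1..m}" using assms by auto
  then have "(\<Sum>j=1..m. short_fraction m (n - j)) = real n * short_fraction m n"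
    by (simp add: short_fraction_rec)
  then show ?thesis using short_fraction_pos[OF assms(1), of n] by (simp add: head_mass_def)
qed

text \<open>
  Moving the first \<open>b\<close> terms up by \<open>d\<close> gives the terms \<open>d + 1, ..., m\<close>, whose sum is what the first \<open>d\<close>
  terms leave of the total \<open>n\<close>.
\<close>

lemma head_mass_shift:
  assumes "m \<ge> 1" "m \<le> n" "b + d = m"
  shows "(\<Sum>j=1..b. short_fraction m (n - j - d)) = (real n - head_mass m n d) * short_fraction m n"
proof -
  have pos: "short_fraction m n > 0" by (rule short_fraction_pos[OF assms(1)])
  have "(\<Sum>j=1..b. short_fraction m (n - j - d)) = (\<Sum>i=d+1..m. short_fraction m (n - i))"
    by (rule sum.reindex_bij_witness[where i = "\<lambda>i. i - d" and j = "\<lambda>j. j + d"])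
       (use assms in auto)
  moreover have "(\<Sum>j=1..m. short_fraction m (n - j))
      = (\<Sum>j=1..d. short_fraction m (n - j)) + (\<Sum>i=d+1..m. short_fraction m (n - i))"
    using assms(3) sum.ub_add_nat[of 1 d "\<lambda>j. short_fraction m (n - j)" b] by (simp add: add.commute)
  moreover have "(\<Sum>j=1..m. short_fraction m (n - j)) = real n * short_fraction m n"
    using head_mass_total[OF assms(1,2)] pos by (simp add: head_mass_def field_simps)
  moreover have "(\<Sum>j=1..d. short_fraction m (n - j)) = head_mass m n d * short_fraction m n"
    using pos by (simp add: head_mass_def)
  ultimately show ?thesis by (simp add: algebra_simps)
qed

lemma head_mass_le:
  assumes "m \<ge> 1" "m \<le> n" "b + d = m"
  shows "step_ratio m (n - m) ^ d * head_mass m n b \<le> real n"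
proof -
  have pos: "short_fraction m n > 0" by (rule short_fraction_pos[OF assms(1)])
  have "step_ratio m (n - m) ^ d * (\<Sum>j=1..b. short_fraction m (n - j))
      = (\<Sum>j=1..b. step_ratio m (n - m) ^ d * short_fraction m (n - j - d + d))"
    unfolding sum_distrib_left using assms by (intro sum.cong) auto
  also have "\<dots> \<le> (\<Sum>j=1..b. short_fraction m (n - j - d))"
    using assms by (intro sum_mono short_fraction_ge_power) auto
  also have "\<dots> = (real n - head_mass m n d) * short_fraction m n"
    by (rule head_mass_shift[OF assms])
  also have "\<dots> \<le> real n * short_fraction m n"
    using pos head_mass_nonneg[OF assms(1)] by (intro mult_right_mono) auto
  finally show ?thesis using pos by (simp add: head_mass_def field_simps)
qed

lemma head_mass_ge:
  assumes "m \<ge> 1" "m \<le> n" "b + d = m"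
  shows "real n - head_mass m n d \<le> step_ratio m (n - 1) ^ d * head_mass m n b"
proof -
  have pos: "short_fraction m n > 0" by (rule short_fraction_pos[OF assms(1)])
  have "(real n - head_mass m n d) * short_fraction m n = (\<Sum>j=1..b. short_fraction m (n - j - d))"
    by (rule head_mass_shift[OF assms, symmetric])
  also have "\<dots> \<le> (\<Sum>j=1..b. step_ratio m (n - 1) ^ d * short_fraction m (n - j - d + d))"
    using assms by (intro sum_mono short_fraction_le_power) auto
  also have "\<dots> = step_ratio m (n - 1) ^ d * (\<Sum>j=1..b. short_fraction m (n - j))"
    unfolding sum_distrib_left using assms by (intro sum.cong) auto
  also have "\<dots> = step_ratio m (n - 1) ^ d * head_mass m n b * short_fraction m n"
    using pos by (simp add: head_mass_def)
  finally show ?thesis using pos by simp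
qed

lemma head_mass_fraction_le:
  assumes "m \<ge> 1" "m \<le> n" "b + d = m"
  shows "head_mass m n b / real n \<le> exp (- (real d * ln (step_ratio m (n - m))))"
proof -
  let ?s = "step_ratio m (n - m)"
  have s: "?s > 0" using step_ratio_ge_1[OF assms(1), of "n - m"] by linarith
  have "exp (- (real d * ln ?s)) = 1 / ?s ^ d"
    using s by (simp add: exp_minus exp_of_nat_mult divide_inverse)
  then show ?thesis using head_mass_le[OF assms] s assms
    by (simp only:) (simp add: field_simps)
qed

text \<open>
  The missing terms \<open>1, ..., d\<close> are themselves a head, with the roles of \<open>b\<close> and \<open>d\<close>
  exchanged, so the upper bound \<open>head_mass_fraction_le\<close> controls them.
\<close>

lemma head_mass_fraction_ge:
  assumes "m \<ge> 1" "m \<le> n" "b + d = m"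
  shows "head_mass m n b / real n \<ge> exp (- (real d * ln (step_ratio m (n - 1))))
           * (1 - exp (- (real b * ln (step_ratio m (n - m)))))"
proof -
  let ?r = "step_ratio m (n - 1)"
  have r: "?r > 0" using step_ratio_ge_1[OF assms(1), of "n - 1"] by linarith
  have n: "real n > 0" using assms by simp
  have e: "exp (- (real d * ln ?r)) = 1 / ?r ^ d"
    using r by (simp add: exp_minus exp_of_nat_mult divide_inverse)
  have "1 - exp (- (real b * ln (step_ratio m (n - m)))) \<le> 1 - head_mass m n d / real n"
    using head_mass_fraction_le[OF assms(1,2), of d b] assms(3) by simp
  also have "\<dots> \<le> ?r ^ d * (head_mass m n b / real n)"
    using divide_right_mono[OF head_mass_ge[OF assms], of "real n"] n
    by (simp add: diff_divide_distrib)
  finally show ?thesis using r unfolding e by (simp add: field_simps)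
qed

text \<open>
  For \<open>k = n - m + 1\<close>, the at most \<open>m\<close> terms of the recurrence for \<open>k p\<^sub>k\<close> are bounded by
  \<open>s\<^sup>m p\<^sub>k\<close> each, so \<open>k \<le> m s\<^sup>m\<close>.
\<close>

lemma step_ratio_ln_ge:
  assumes "m \<ge> 1" "m \<le> n"
  shows "ln (real (n - m + 1) / real m) \<le> real m * ln (step_ratio m (n - m))"
proof -
  let ?s = "step_ratio m (n - m)" and ?k = "Suc (n - m)"
  have s: "?s \<ge> 1" by (rule step_ratio_ge_1[OF assms(1)])
  have pos: "short_fraction m ?k > 0" by (rule short_fraction_pos[OF assms(1)])
  have "real ?k * short_fraction m ?k = (\<Sum>j | j \<in> {1..m} \<and> j \<le> ?k. short_fraction m (?k - j))"
    by (rule short_fraction_rec)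
  also have "\<dots> \<le> (\<Sum>j | j \<in> {1..m} \<and> j \<le> ?k. ?s ^ m * short_fraction m ?k)"
  proof (intro sum_mono)
    fix j assume j: "j \<in> {j. j \<in> {1..m} \<and> j \<le> ?k}"
    then have "short_fraction m (?k - j) \<le> ?s ^ j * short_fraction m (?k - j + j)"
      by (intro short_fraction_le_power[OF assms(1)]) auto
    also have "?k - j + j = ?k" using j by simp
    also have "?s ^ j * short_fraction m ?k \<le> ?s ^ m * short_fraction m ?k"
      using s j pos by (intro mult_right_mono power_increasing) auto
    finally show "short_fraction m (?k - j) \<le> ?s ^ m * short_fraction m ?k" .
  qed
  also have "\<dots> \<le> (\<Sum>j\<in>{1..m}. ?s ^ m * short_fraction m ?k)"
    using s pos by (intro sum_mono2) auto
  also have "\<dots> = (real m * ?s ^ m) * short_fraction m ?k" by simp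
  finally have "real ?k \<le> real m * ?s ^ m" using pos by (subst (asm) mult_le_cancel_right_pos)
  then have "real (n - m + 1) / real m \<le> ?s ^ m" using assms by (simp add: field_simps)
  then have "ln (real (n - m + 1) / real m) \<le> ln (?s ^ m)"
    using assms s by (subst ln_le_cancel_iff) auto
  then show ?thesis using s by (simp add: ln_realpow)
qed

text \<open>
  From \<open>e\<^sup>y \<le> (1 + y) M\<close> one gets \<open>y \<le> ln M + ln (1 + y)\<close>; a first crude use of this,
  \<open>y \<le> 2 ln M + 2\<close>, is inserted into the logarithm on the right.
\<close>

lemma le_ln_of_exp_le:
  fixes y M :: real
  assumes y: "y \<ge> 0" and M: "M \<ge> 1" and le: "exp y - 1 \<le> y * M"
  shows "y \<le> ln M + ln (3 + 2 * ln M)"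
proof -
  have "exp y \<le> (1 + y) * M" using le M by (simp add: algebra_simps)
  then have "ln (exp y) \<le> ln ((1 + y) * M)" using y M by (subst ln_le_cancel_iff) auto
  then have 1: "y \<le> ln (1 + y) + ln M" using y M by (simp add: ln_mult)
  have "ln (1 + y) = ln 2 + ln ((1 + y) / 2)" using y by (simp add: ln_div)
  also have "\<dots> \<le> 1 + ((1 + y) / 2 - 1)"
    using y ln_2_less_1 by (intro add_mono ln_le_minus_one) auto
  finally have "y \<le> 2 * ln M + 2" using 1 by (simp add: field_simps)
  then have "ln (1 + y) \<le> ln (3 + 2 * ln M)" using y by (subst ln_le_cancel_iff) auto
  then show ?thesis using 1 by simp
qed

text \<open>
  The recurrence at \<open>n + m\<close> involves \<open>R\<^sub>k\<close> only for \<open>k \<ge> n\<close>, so \<open>r + ... + r\<^sup>m \<le> n + m\<close> for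
  \<open>r = R\<^bsub>n-1\<^esub>\<close>. Summing the geometric series and using \<open>1 - 1/r \<le> ln r\<close> gives
  \<open>r\<^sup>m - 1 \<le> (n + m) ln r\<close>.
\<close>

lemma step_ratio_ln_le:
  assumes "m \<ge> 1" "m \<le> n"
  defines "M \<equiv> (real n + real m) / real m"
  shows "real m * ln (step_ratio m (n - 1)) \<le> ln M + ln (3 + 2 * ln M)"
proof (rule le_ln_of_exp_le)
  let ?r = "step_ratio m (n - 1)"
  have r: "?r \<ge> 1" by (rule step_ratio_ge_1[OF assms(1)])
  have pos: "short_fraction m (n + m) > 0" by (rule short_fraction_pos[OF assms(1)])
  show "real m * ln ?r \<ge> 0" using r by simp
  show "M \<ge> 1" using assms by (simp add: M_def)
  have "(\<Sum>j=1..m. ?r ^ j) * short_fraction m (n + m)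
      = (\<Sum>j=1..m. ?r ^ j * short_fraction m (n + m - j + j))"
    unfolding sum_distrib_right by (intro sum.cong) auto
  also have "\<dots> \<le> (\<Sum>j=1..m. short_fraction m (n + m - j))"
    by (intro sum_mono short_fraction_ge_power[OF assms(1)]) auto
  also have "\<dots> = real (n + m) * short_fraction m (n + m)"
    using head_mass_total[OF assms(1), of "n + m"] pos by (simp add: head_mass_def field_simps)
  finally have sum_le: "(\<Sum>j=1..m. ?r ^ j) \<le> real (n + m)" using pos by (subst (asm) mult_le_cancel_right_pos)
  have "?r ^ m - 1 = (1 - 1 / ?r) * (\<Sum>j=1..m. ?r ^ j)"
  proof -
    have "(\<Sum>j=1..m. ?r ^ j) = ?r * (\<Sum>j<m. ?r ^ j)"
      unfolding sum_distrib_left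
      by (rule sum.reindex_bij_witness[where i = Suc and j = "\<lambda>j. j - 1"])
         (auto simp: power_eq_if)
    then have "(1 - 1 / ?r) * (\<Sum>j=1..m. ?r ^ j) = (?r - 1) * (\<Sum>j<m. ?r ^ j)"
      using r by (simp add: algebra_simps)
    then show ?thesis by (simp add: power_diff_1_eq)
  qed
  also have "\<dots> \<le> ln ?r * real (n + m)"
  proof (intro mult_mono sum_le)
    have "ln (1 / ?r) \<le> 1 / ?r - 1" using r by (intro ln_le_minus_one) auto
    then show "1 - 1 / ?r \<le> ln ?r" using r by (simp add: ln_div)
  qed (use r in \<open>auto intro!: sum_nonneg\<close>)
  also have "\<dots> = real m * ln ?r * M" using assms by (simp add: M_def)
  finally show "exp (real m * ln ?r) - 1 \<le> real m * ln ?r * M"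
    using r by (simp add: exp_of_nat_mult)
qed

lemma mean_cycles_ge:
  assumes "m \<ge> 1" "b \<le> m"
  shows "head_mass m n b / real m \<le> mean_cycles m n b"
proof -
  have pos: "short_fraction m k > 0" for k by (rule short_fraction_pos[OF assms(1)])
  have "(\<Sum>j=1..b. short_fraction m (n - j)) / real m \<le> (\<Sum>j=1..b. short_fraction m (n - j) / real j)"
    unfolding sum_divide_distrib using assms less_imp_le[OF pos]
    by (intro sum_mono divide_left_mono) auto
  then show ?thesis
    unfolding head_mass_def mean_cycles_def using less_imp_le[OF pos]
    by (metis divide_divide_eq_left divide_right_mono mult.commute)
qed

text \<open>
  The estimate \<open>1/j \<ge> 1/m\<close> has the wrong direction for an upper bound. It has the right one when
  applied to the terms with \<open>j > b\<close>, which are subtracted from the total mean; so the upper bound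
  reduces to one for the total mean.
\<close>

lemma mean_cycles_le:
  assumes "m \<ge> 1" "m \<le> n" "b \<le> m"
  shows "mean_cycles m n b \<le> mean_cycles m n m - real n / real m + head_mass m n b / real m"
proof -
  let ?p = "short_fraction m"
  have pos: "?p k > 0" for k by (rule short_fraction_pos[OF assms(1)])
  obtain d where d: "m = b + d" using assms(3) le_Suc_ex by blast
  have "(\<Sum>j=b+1..m. ?p (n - j)) / real m \<le> (\<Sum>j=b+1..m. ?p (n - j) / real j)"
    unfolding sum_divide_distrib using assms less_imp_le[OF pos]
    by (intro sum_mono divide_left_mono) auto
  then have "(\<Sum>j=b+1..m. ?p (n - j)) / ?p n / real m \<le> (\<Sum>j=b+1..m. ?p (n - j) / real j) / ?p n"
    using less_imp_le[OF pos] by (metis divide_divide_eq_left divide_right_mono mult.commute)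
  moreover have "(\<Sum>j=b+1..m. ?p (n - j)) / ?p n = head_mass m n m - head_mass m n b"
    using sum.ub_add_nat[of 1 b "\<lambda>j. ?p (n - j)" d] by (simp add: head_mass_def d add_divide_distrib)
  moreover have "(\<Sum>j=b+1..m. ?p (n - j) / real j) / ?p n = mean_cycles m n m - mean_cycles m n b"
    using sum.ub_add_nat[of 1 b "\<lambda>j. ?p (n - j) / real j" d]
    by (simp add: mean_cycles_def d add_divide_distrib)
  ultimately have "(real n - head_mass m n b) / real m \<le> mean_cycles m n m - mean_cycles m n b"
    using head_mass_total[OF assms(1,2)] by (simp only:)
  then show ?thesis by (simp add: diff_divide_distrib)
qed

text \<open>
  Lengths \<open>j \<ge> (1-\<delta>) m\<close> contribute at most \<open>n / ((1-\<delta>) m)\<close>. For smaller \<open>j\<close> the bound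
  \<open>q\<^sub>j \<le> r\<^sup>j \<le> r powr ((1-\<delta>) m)\<close> is used, which is roughly \<open>n/m\<close> to the power \<open>1-\<delta>\<close>; the
  weights \<open>1/j\<close> then contribute no more than a harmonic sum.
\<close>

lemma mean_cycles_total_le:
  assumes "m \<ge> 1" "m \<le> n" and \<delta>: "0 \<le> \<delta>" "\<delta> < 1"
  shows "mean_cycles m n m \<le> real n / ((1 - \<delta>) * real m)
     + exp ((1 - \<delta>) * (real m * ln (step_ratio m (n - 1)))) * (1 + ln (real m))"
proof -
  let ?p = "short_fraction m" and ?r = "step_ratio m (n - 1)"
  let ?E = "exp ((1 - \<delta>) * (real m * ln ?r))"
  have pos: "?p k > 0" for k by (rule short_fraction_pos[OF assms(1)])
  have r: "?r \<ge> 1" by (rule step_ratio_ge_1[OF assms(1)])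
  have m\<delta>: "(1 - \<delta>) * real m > 0" using assms by simp
  have bound: "?p (n - j) / real j \<le> ?p (n - j) / ((1 - \<delta>) * real m) + ?E * ?p n / real j"
    if j: "j \<in> {1..m}" for j
  proof (cases "(1 - \<delta>) * real m \<le> real j")
    case True
    then have "?p (n - j) / real j \<le> ?p (n - j) / ((1 - \<delta>) * real m)"
      using less_imp_le[OF pos] m\<delta> by (intro divide_left_mono) auto
    moreover have "0 \<le> ?E * ?p n / real j" using less_imp_le[OF pos] by simp
    ultimately show ?thesis by linarith
  next
    case False
    have "?p (n - j) \<le> ?r ^ j * ?p (n - j + j)"
      using j assms(2) by (intro short_fraction_le_power[OF assms(1)]) auto
    also have "n - j + j = n" using j assms(2) by simp
    also have "?r ^ j = exp (real j * ln ?r)" using r by (simp add: exp_of_nat_mult)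
    also have "exp (real j * ln ?r) \<le> ?E"
      using False r by (simp add: mult_right_mono flip: mult.assoc)
    finally have "?p (n - j) / real j \<le> ?E * ?p n / real j"
      using less_imp_le[OF pos] by (intro divide_right_mono) (auto simp: mult_right_mono)
    moreover have "0 \<le> ?p (n - j) / ((1 - \<delta>) * real m)" using less_imp_le[OF pos] m\<delta> by simp
    ultimately show ?thesis by linarith
  qed
  have "(\<Sum>j=1..m. ?p (n - j) / real j)
      \<le> (\<Sum>j=1..m. ?p (n - j) / ((1 - \<delta>) * real m) + ?E * ?p n / real j)"
    by (intro sum_mono bound)
  also have "\<dots> = (\<Sum>j=1..m. ?p (n - j)) / ((1 - \<delta>) * real m) + ?E * ?p n * harm m"
    by (simp add: sum.distrib harm_def sum_distrib_left divide_inverse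
        flip: sum_divide_distrib sum_distrib_right)
  also have "(\<Sum>j=1..m. ?p (n - j)) = real n * ?p n"
    using head_mass_total[OF assms(1,2)] pos[of n] by (simp add: head_mass_def field_simps)
  also have "?E * ?p n * harm m \<le> ?E * ?p n * (1 + ln (real m))"
  proof (intro mult_left_mono)
    show "harm m \<le> 1 + ln (real m)"
      using euler_mascheroni_sequence_decreasing[of 1 m] assms(1) by (simp add: harm_def)
  qed (use less_imp_le[OF pos] in auto)
  finally have "mean_cycles m n m
      \<le> (real n * ?p n / ((1 - \<delta>) * real m) + ?E * ?p n * (1 + ln (real m))) / ?p n"
    unfolding mean_cycles_def using less_imp_le[OF pos] by (intro divide_right_mono) auto
  also have "\<dots> = real n / ((1 - \<delta>) * real m) + ?E * (1 + ln (real m))"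
    using pos[of n] by (simp add: add_divide_distrib)
  finally show ?thesis .
qed

section \<open>Asymptotics of the mean\<close>

text \<open>
  In the notation used above, \<open>maxlen n\<close> is \<open>m\<close> and \<open>loglen n\<close> is \<open>L\<close>; \<open>lo_rate n\<close> and
  \<open>hi_rate n\<close> are \<open>ln s\<close> and \<open>ln r\<close>.
\<close>

locale cycle_length_bound =
  fixes a1 a2 :: real and \<alpha> :: "nat \<Rightarrow> real"
  assumes a1: "0 < a1" and a2: "a2 < 1"
    and bounds: "\<And>n. n \<ge> 1 \<Longrightarrow> real n powr a1 \<le> \<alpha> n \<and> \<alpha> n \<le> real n powr a2"
begin

definition maxlen :: "nat \<Rightarrow> nat" where "maxlen n = nat \<lfloor>\<alpha> n\<rfloor>"

definition loglen :: "nat \<Rightarrow> real" where "loglen n = ln (real n / \<alpha> n)"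

lemma alpha_pos: "n \<ge> 1 \<Longrightarrow> \<alpha> n > 0"
  using bounds[of n] by (smt (verit) of_nat_0_less_iff less_le_trans zero_less_one powr_gt_zero)

lemma alpha_at_top: "filterlim \<alpha> at_top sequentially"
proof (rule filterlim_at_top_mono)
  show "filterlim (\<lambda>n. real n powr a1) at_top sequentially" using a1 by real_asymp
  show "eventually (\<lambda>n. real n powr a1 \<le> \<alpha> n) sequentially"
    using eventually_ge_at_top[of 1] by eventually_elim (use bounds in auto)
qed

lemma loglen_bounds:
  assumes "n \<ge> 1"
  shows "(1 - a2) * ln (real n) \<le> loglen n" "loglen n \<le> ln (real n)"
proof -
  have pos: "\<alpha> n > 0" "real n > 0" using alpha_pos[OF assms] assms by auto
  have eq: "loglen n = ln (real n) - ln (\<alpha> n)" using pos by (simp add: loglen_def ln_div)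
  have "ln (\<alpha> n) \<le> ln (real n powr a2)"
    using bounds[OF assms] pos by (intro ln_mono) auto
  then show "(1 - a2) * ln (real n) \<le> loglen n" using pos by (simp add: eq ln_powr algebra_simps)
  have "ln (real n powr a1) \<le> ln (\<alpha> n)"
    using bounds[OF assms] pos by (intro ln_mono) auto
  moreover have "0 \<le> a1 * ln (real n)" using a1 assms by simp
  ultimately show "loglen n \<le> ln (real n)" using pos by (simp only: eq ln_powr)
qed

lemma loglen_at_top: "filterlim loglen at_top sequentially"
proof (rule filterlim_at_top_mono)
  show "filterlim (\<lambda>n. (1 - a2) * ln (real n)) at_top sequentially" using a2 by real_asymp
  show "eventually (\<lambda>n. (1 - a2) * ln (real n) \<le> loglen n) sequentially"
    using eventually_ge_at_top[of 1] by eventually_elim (use loglen_bounds in auto)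
qed

lemma eventually_loglen_pos: "eventually (\<lambda>n. loglen n > 0) sequentially"
  using loglen_at_top by (simp add: filterlim_at_top_dense)

lemma eventually_ge_1: "eventually (\<lambda>n. n \<ge> (1::nat)) sequentially"
  by (rule eventually_ge_at_top)

lemma loglen_over_alpha: "(\<lambda>n. loglen n / \<alpha> n) \<longlonglongrightarrow> 0"
proof (rule tendsto_sandwich)
  show "eventually (\<lambda>n. 0 \<le> loglen n / \<alpha> n) sequentially"
    using eventually_loglen_pos eventually_ge_1
    by eventually_elim (auto intro!: divide_nonneg_pos alpha_pos)
  show "eventually (\<lambda>n. loglen n / \<alpha> n \<le> ln (real n) / real n powr a1) sequentially"
    using eventually_ge_1
    by eventually_elim (intro frac_le, use loglen_bounds bounds in auto)
  show "(\<lambda>n. ln (real n) / real n powr a1) \<longlonglongrightarrow> 0" using a1 by real_asymp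
qed simp

lemma inverse_quotient: "(\<lambda>n. \<alpha> n / real n) \<longlonglongrightarrow> 0"
proof (rule tendsto_sandwich)
  show "eventually (\<lambda>n. 0 \<le> \<alpha> n / real n) sequentially"
    using eventually_ge_1 by eventually_elim (auto intro!: divide_nonneg_pos less_imp_le[OF alpha_pos])
  show "eventually (\<lambda>n. \<alpha> n / real n \<le> real n powr a2 / real n) sequentially"
    using eventually_ge_1 by eventually_elim (intro divide_right_mono, use bounds in auto)
  show "(\<lambda>n. real n powr a2 / real n) \<longlonglongrightarrow> 0" using a2 by real_asymp
qed simp

lemma maxlen_bounds:
  assumes "n \<ge> 1"
  shows "\<alpha> n - 1 < real (maxlen n)" "real (maxlen n) \<le> \<alpha> n"
  using alpha_pos[OF assms] by (simp_all add: maxlen_def)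

lemma maxlen_over_alpha: "(\<lambda>n. real (maxlen n) / \<alpha> n) \<longlonglongrightarrow> 1"
proof (rule tendsto_sandwich)
  show "eventually (\<lambda>n. 1 - inverse (\<alpha> n) \<le> real (maxlen n) / \<alpha> n) sequentially"
    using eventually_ge_1
  proof eventually_elim
    case (elim n)
    have "(\<alpha> n - 1) / \<alpha> n \<le> real (maxlen n) / \<alpha> n"
      using maxlen_bounds[OF elim] alpha_pos[OF elim] by (intro divide_right_mono) auto
    then show ?case using alpha_pos[OF elim] by (simp add: diff_divide_distrib inverse_eq_divide)
  qed
  show "eventually (\<lambda>n. real (maxlen n) / \<alpha> n \<le> 1) sequentially"
    using eventually_ge_1
  proof eventually_elim
    case (elim n)
    then show ?case using maxlen_bounds[OF elim] alpha_pos[OF elim] by (simp add: field_simps)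
  qed
  show "(\<lambda>n. 1 - inverse (\<alpha> n)) \<longlonglongrightarrow> 1"
    using tendsto_diff[OF tendsto_const tendsto_inverse_0_at_top[OF alpha_at_top], of 1] by simp
qed simp

lemma alpha_over_maxlen: "(\<lambda>n. \<alpha> n / real (maxlen n)) \<longlonglongrightarrow> 1"
  using tendsto_inverse[OF maxlen_over_alpha] by (simp add: field_simps)

lemma maxlen_over_n: "(\<lambda>n. real (maxlen n) / real n) \<longlonglongrightarrow> 0"
proof -
  have "(\<lambda>n. (real (maxlen n) / \<alpha> n) * (\<alpha> n / real n)) \<longlonglongrightarrow> 1 * 0"
    by (intro tendsto_mult maxlen_over_alpha inverse_quotient)
  then have "(\<lambda>n. (real (maxlen n) / \<alpha> n) * (\<alpha> n / real n)) \<longlonglongrightarrow> 0" by (simp only: mult_zero_right)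
  moreover have "eventually (\<lambda>n. (real (maxlen n) / \<alpha> n) * (\<alpha> n / real n) = real (maxlen n) / real n) sequentially"
    using eventually_ge_1
  proof eventually_elim
    case (elim n)
    then show ?case using alpha_pos[OF elim] by simp
  qed
  ultimately show ?thesis by (rule Lim_transform_eventually)
qed

lemma eventually_maxlen: "eventually (\<lambda>n. 1 \<le> maxlen n \<and> maxlen n \<le> n \<and> n \<ge> 1) sequentially"
proof -
  have "eventually (\<lambda>n. \<alpha> n \<ge> 2) sequentially"
    using alpha_at_top by (simp add: filterlim_at_top)
  moreover have "eventually (\<lambda>n. real (maxlen n) / real n < 1) sequentially"
    using order_tendstoD(2)[OF maxlen_over_n] by simp
  ultimately show ?thesis using eventually_ge_1
  proof eventually_elim
    case (elim n)
    then show ?case using maxlen_bounds[of n] by (simp add: field_simps)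
  qed
qed

lemma ln_lower_gap: "(\<lambda>n. ln (real (n - maxlen n + 1) / real (maxlen n)) - loglen n) \<longlonglongrightarrow> 0"
proof -
  have "(\<lambda>n. ln ((1 - real (maxlen n) / real n + 1 / real n) * (\<alpha> n / real (maxlen n))))
      \<longlonglongrightarrow> ln ((1 - 0 + 0) * 1)" (is "?f \<longlonglongrightarrow> _")
    by (intro tendsto_ln tendsto_mult tendsto_add tendsto_diff tendsto_const maxlen_over_n
        alpha_over_maxlen lim_1_over_n) auto
  then have "?f \<longlonglongrightarrow> 0" by (simp only: ln_one diff_zero add_0_right mult_1)
  moreover have "eventually (\<lambda>n. ln ((1 - real (maxlen n) / real n + 1 / real n) * (\<alpha> n / real (maxlen n)))
      = ln (real (n - maxlen n + 1) / real (maxlen n)) - loglen n) sequentially"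
    using eventually_maxlen
  proof eventually_elim
    case (elim n)
    then have pos: "\<alpha> n > 0" "real n > 0" "real (maxlen n) > 0" using alpha_pos[of n] by auto
    have "(1 - real (maxlen n) / real n + 1 / real n) * (\<alpha> n / real (maxlen n))
        = (real (n - maxlen n + 1) / real (maxlen n)) / (real n / \<alpha> n)"
      using elim pos by (simp add: field_simps)
    then show ?case unfolding loglen_def using pos by (simp only:) (intro ln_divide_pos; simp)
  qed
  ultimately show ?thesis by (rule Lim_transform_eventually)
qed

lemma ln_upper_gap: "(\<lambda>n. ln ((real n + real (maxlen n)) / real (maxlen n)) - loglen n) \<longlonglongrightarrow> 0"
proof -
  have "(\<lambda>n. ln ((1 + real (maxlen n) / real n) * (\<alpha> n / real (maxlen n)))) \<longlonglongrightarrow> ln ((1 + 0) * 1)"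
    (is "?f \<longlonglongrightarrow> _")
    by (intro tendsto_ln tendsto_mult tendsto_add tendsto_const maxlen_over_n alpha_over_maxlen) auto
  then have "?f \<longlonglongrightarrow> 0" by (simp only: ln_one add_0_right mult_1)
  moreover have "eventually (\<lambda>n. ln ((1 + real (maxlen n) / real n) * (\<alpha> n / real (maxlen n)))
      = ln ((real n + real (maxlen n)) / real (maxlen n)) - loglen n) sequentially"
    using eventually_maxlen
  proof eventually_elim
    case (elim n)
    then have pos: "\<alpha> n > 0" "real n > 0" "real (maxlen n) > 0" using alpha_pos[of n] by auto
    have "(1 + real (maxlen n) / real n) * (\<alpha> n / real (maxlen n))
        = ((real n + real (maxlen n)) / real (maxlen n)) / (real n / \<alpha> n)"
      using elim pos by (simp add: field_simps)
    moreover have "(real n + real (maxlen n)) / real (maxlen n) > 0" using pos by simp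
    ultimately show ?case unfolding loglen_def using pos by (simp only:) (intro ln_divide_pos; simp)
  qed
  ultimately show ?thesis by (rule Lim_transform_eventually)
qed

definition lo_rate :: "nat \<Rightarrow> real" where
  "lo_rate n = ln (step_ratio (maxlen n) (n - maxlen n))"

definition hi_rate :: "nat \<Rightarrow> real" where
  "hi_rate n = ln (step_ratio (maxlen n) (n - 1))"

text \<open>
  Both rates times \<open>m\<close> agree with \<open>L = ln (n/\<alpha>)\<close> up to \<open>O(ln L)\<close>; only the quotient with \<open>L\<close>
  matters for the sequel, except in the total mean, where the error is exponentiated and has to
  be \<open>o(sqrt L)\<close>.
\<close>

lemma eventually_rates:
  "eventually (\<lambda>n. loglen n - 1 \<le> real (maxlen n) * lo_rate n \<and> 0 \<le> lo_rate n
     \<and> lo_rate n \<le> hi_rate n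
     \<and> real (maxlen n) * hi_rate n \<le> loglen n + 1 + ln (5 + 2 * loglen n)) sequentially"
proof -
  have "eventually (\<lambda>n. -1 < ln (real (n - maxlen n + 1) / real (maxlen n)) - loglen n) sequentially"
    using order_tendstoD(1)[OF ln_lower_gap] by simp
  moreover have "eventually (\<lambda>n. ln ((real n + real (maxlen n)) / real (maxlen n)) - loglen n < 1) sequentially"
    using order_tendstoD(2)[OF ln_upper_gap] by simp
  ultimately show ?thesis using eventually_maxlen eventually_loglen_pos
  proof eventually_elim
    case (elim n)
    let ?m = "maxlen n"
    define L where "L = ln ((real n + real ?m) / real ?m)"
    have m: "1 \<le> ?m" "?m \<le> n" using elim by auto
    have r1: "1 \<le> step_ratio ?m (n - ?m)" by (rule step_ratio_ge_1[OF m(1)])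
    have r2: "step_ratio ?m (n - ?m) \<le> step_ratio ?m (n - 1)"
      using m by (intro monoD[OF mono_step_ratio]) auto
    have L: "0 \<le> L" "L \<le> loglen n + 1" using elim by (auto simp: L_def)
    have "real ?m * hi_rate n \<le> L + ln (3 + 2 * L)"
      using step_ratio_ln_le[OF m] by (simp add: hi_rate_def L_def)
    also have "\<dots> \<le> (loglen n + 1) + ln (5 + 2 * loglen n)"
      using L by (intro add_mono) auto
    finally have "real ?m * hi_rate n \<le> loglen n + 1 + ln (5 + 2 * loglen n)" by simp
    moreover have "loglen n - 1 \<le> real ?m * lo_rate n"
      using step_ratio_ln_ge[OF m] elim by (simp add: lo_rate_def)
    moreover have "0 \<le> lo_rate n" "lo_rate n \<le> hi_rate n"
      using r1 r2 by (auto simp: lo_rate_def hi_rate_def)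
    ultimately show ?case by simp
  qed
qed

lemma rate_limits:
  shows "(\<lambda>n. real (maxlen n) * lo_rate n / loglen n) \<longlonglongrightarrow> 1"
    and "(\<lambda>n. real (maxlen n) * hi_rate n / loglen n) \<longlonglongrightarrow> 1"
proof -
  have ev: "eventually (\<lambda>n. (loglen n - 1) / loglen n \<le> real (maxlen n) * lo_rate n / loglen n
      \<and> real (maxlen n) * lo_rate n / loglen n \<le> real (maxlen n) * hi_rate n / loglen n
      \<and> real (maxlen n) * hi_rate n / loglen n \<le> (loglen n + 1 + ln (5 + 2 * loglen n)) / loglen n) sequentially"
    using eventually_rates eventually_loglen_pos
    by eventually_elim (intro conjI divide_right_mono mult_left_mono; simp)
  have "((\<lambda>x::real. (x - 1) / x) \<longlongrightarrow> 1) at_top" by real_asymp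
  from filterlim_compose[OF this loglen_at_top]
  have lo: "(\<lambda>n. (loglen n - 1) / loglen n) \<longlonglongrightarrow> 1" .
  have "((\<lambda>x::real. (x + 1 + ln (5 + 2 * x)) / x) \<longlongrightarrow> 1) at_top" by real_asymp
  from filterlim_compose[OF this loglen_at_top]
  have hi: "(\<lambda>n. (loglen n + 1 + ln (5 + 2 * loglen n)) / loglen n) \<longlonglongrightarrow> 1" .
  show "(\<lambda>n. real (maxlen n) * lo_rate n / loglen n) \<longlonglongrightarrow> 1"
    by (rule tendsto_sandwich[OF _ _ lo hi]) (use ev in \<open>auto elim!: eventually_mono\<close>)
  show "(\<lambda>n. real (maxlen n) * hi_rate n / loglen n) \<longlonglongrightarrow> 1"
    by (rule tendsto_sandwich[OF _ _ lo hi]) (use ev in \<open>auto elim!: eventually_mono\<close>)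
qed

text \<open>
  For \<open>0 < t \<le> 1\<close> the threshold of the theorem is eventually \<open>\<alpha> n - offset t n\<close>, cut off at 0; see
  \<open>threshold_offset\<close>.
\<close>

definition offset :: "real \<Rightarrow> nat \<Rightarrow> nat" where
  "offset t n = nat (- \<lfloor>ln t * (\<alpha> n / loglen n)\<rfloor>)"

lemma real_offset:
  assumes "0 < t" "t \<le> 1" "n \<ge> 1" "loglen n > 0"
  shows "real (offset t n) = - of_int \<lfloor>ln t * (\<alpha> n / loglen n)\<rfloor>"
proof -
  have "ln t * (\<alpha> n / loglen n) \<le> 0"
    using assms alpha_pos[OF assms(3)] by (intro mult_nonpos_nonneg) auto
  then have "\<lfloor>ln t * (\<alpha> n / loglen n)\<rfloor> \<le> 0" by (simp add: floor_le_iff)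
  then show ?thesis by (simp add: offset_def)
qed

lemma offset_limit:
  assumes t: "0 < t" "t \<le> 1"
  shows "(\<lambda>n. real (offset t n) * loglen n / real (maxlen n)) \<longlonglongrightarrow> - ln t"
proof -
  have "(\<lambda>n. real (offset t n) * loglen n / \<alpha> n) \<longlonglongrightarrow> - ln t"
  proof (rule tendsto_sandwich)
    have *: "eventually (\<lambda>n. - ln t \<le> real (offset t n) * loglen n / \<alpha> n
        \<and> real (offset t n) * loglen n / \<alpha> n \<le> - ln t + loglen n / \<alpha> n) sequentially"
      using eventually_loglen_pos eventually_ge_1
    proof eventually_elim
      case (elim n)
      let ?x = "ln t * (\<alpha> n / loglen n)"
      have pos: "\<alpha> n > 0" using alpha_pos elim by simp
      have fl: "real (offset t n) = - of_int \<lfloor>?x\<rfloor>" using real_offset[OF t] elim by simp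
      have "- ?x \<le> real (offset t n)" "real (offset t n) \<le> - ?x + 1" unfolding fl by linarith+
      then have "- ?x * (loglen n / \<alpha> n) \<le> real (offset t n) * (loglen n / \<alpha> n)"
        "real (offset t n) * (loglen n / \<alpha> n) \<le> (- ?x + 1) * (loglen n / \<alpha> n)"
        using pos elim by (intro mult_right_mono; simp)+
      moreover have "- ?x * (loglen n / \<alpha> n) = - ln t"
        "(- ?x + 1) * (loglen n / \<alpha> n) = - ln t + loglen n / \<alpha> n"
        using pos elim by (simp_all add: field_simps)
      ultimately show ?case by (simp only: times_divide_eq_right)
    qed
    show "eventually (\<lambda>n. - ln t \<le> real (offset t n) * loglen n / \<alpha> n) sequentially"
      using * by (auto elim: eventually_mono)
    show "eventually (\<lambda>n. real (offset t n) * loglen n / \<alpha> n \<le> - ln t + loglen n / \<alpha> n) sequentially"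
      using * by (auto elim: eventually_mono)
    show "(\<lambda>n. - ln t + loglen n / \<alpha> n) \<longlonglongrightarrow> - ln t"
      using tendsto_add[OF tendsto_const loglen_over_alpha, of "- ln t"] by simp
  qed simp
  from tendsto_mult[OF this alpha_over_maxlen]
  have "(\<lambda>n. real (offset t n) * loglen n / \<alpha> n * (\<alpha> n / real (maxlen n))) \<longlonglongrightarrow> - ln t" by simp
  moreover have "eventually (\<lambda>n. real (offset t n) * loglen n / \<alpha> n * (\<alpha> n / real (maxlen n))
      = real (offset t n) * loglen n / real (maxlen n)) sequentially"
    using eventually_ge_1
  proof eventually_elim
    case (elim n)
    then show ?case using alpha_pos[OF elim] by simp
  qed
  ultimately show ?thesis by (rule Lim_transform_eventually)
qed

lemma offset_rate_limits:
  assumes t: "0 < t" "t \<le> 1"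
  shows "(\<lambda>n. real (offset t n) * lo_rate n) \<longlonglongrightarrow> - ln t"
    and "(\<lambda>n. real (offset t n) * hi_rate n) \<longlonglongrightarrow> - ln t"
proof -
  have *: "(\<lambda>n. real (offset t n) * y n) \<longlonglongrightarrow> - ln t"
    if "(\<lambda>n. real (maxlen n) * y n / loglen n) \<longlonglongrightarrow> 1" for y
  proof -
    have "(\<lambda>n. real (offset t n) * loglen n / real (maxlen n) * (real (maxlen n) * y n / loglen n))
        \<longlonglongrightarrow> - ln t * 1" (is "?f \<longlonglongrightarrow> _")
      by (intro tendsto_mult offset_limit t that)
    then have "?f \<longlonglongrightarrow> - ln t" by (simp only: mult_1_right)
    moreover have "eventually (\<lambda>n. real (offset t n) * loglen n / real (maxlen n)
        * (real (maxlen n) * y n / loglen n) = real (offset t n) * y n) sequentially"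
      using eventually_maxlen eventually_loglen_pos by eventually_elim simp
    ultimately show ?thesis by (rule Lim_transform_eventually)
  qed
  show "(\<lambda>n. real (offset t n) * lo_rate n) \<longlonglongrightarrow> - ln t"
    "(\<lambda>n. real (offset t n) * hi_rate n) \<longlonglongrightarrow> - ln t"
    using rate_limits by (auto intro: *)
qed

lemma eventually_offset_le:
  assumes t: "0 < t" "t \<le> 1"
  shows "eventually (\<lambda>n. offset t n \<le> maxlen n) sequentially"
proof -
  have "(\<lambda>n. real (offset t n) * loglen n / real (maxlen n) * inverse (loglen n)) \<longlonglongrightarrow> - ln t * 0"
    by (intro tendsto_mult offset_limit t tendsto_inverse_0_at_top loglen_at_top)
  then have "eventually (\<lambda>n. real (offset t n) * loglen n / real (maxlen n) * inverse (loglen n) < 1) sequentially"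
    using order_tendstoD(2) by fastforce
  then show ?thesis using eventually_maxlen eventually_loglen_pos
  proof eventually_elim
    case (elim n)
    then have "real (offset t n) / real (maxlen n) < 1" by (simp add: field_simps)
    then show ?case using elim by (simp add: divide_less_eq_1)
  qed
qed

lemma head_mass_limit:
  assumes t: "0 < t" "t \<le> 1"
  shows "(\<lambda>n. head_mass (maxlen n) n (maxlen n - offset t n) / real n) \<longlonglongrightarrow> t"
proof (rule tendsto_sandwich)
  let ?b = "\<lambda>n. maxlen n - offset t n"
  have ev: "eventually (\<lambda>n. 1 \<le> maxlen n \<and> maxlen n \<le> n \<and> ?b n + offset t n = maxlen n) sequentially"
    using eventually_maxlen eventually_offset_le[OF t] by eventually_elim auto
  show "eventually (\<lambda>n. head_mass (maxlen n) n (?b n) / real n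
      \<le> exp (- (real (offset t n) * lo_rate n))) sequentially"
    using ev by eventually_elim (auto simp: lo_rate_def intro!: head_mass_fraction_le)
  show "eventually (\<lambda>n. exp (- (real (offset t n) * hi_rate n)) * (1 - exp (- (real (?b n) * lo_rate n)))
      \<le> head_mass (maxlen n) n (?b n) / real n) sequentially"
    using ev unfolding lo_rate_def hi_rate_def
    by eventually_elim (intro head_mass_fraction_ge, simp_all only:)
  have "(\<lambda>n. exp (- (real (offset t n) * lo_rate n))) \<longlonglongrightarrow> exp (- (- ln t))"
    by (intro tendsto_exp tendsto_minus offset_rate_limits t)
  then show "(\<lambda>n. exp (- (real (offset t n) * lo_rate n))) \<longlonglongrightarrow> t" using t by simp
  have "filterlim (\<lambda>n. real (?b n) * lo_rate n) at_top sequentially"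
  proof (rule filterlim_at_top_mono)
    have "filterlim (\<lambda>n. - (real (offset t n) * lo_rate n) - 1 + loglen n) at_top sequentially"
      by (rule filterlim_tendsto_add_at_top[where c = "- (- ln t) - 1", OF _ loglen_at_top])
         (intro tendsto_diff tendsto_minus offset_rate_limits t tendsto_const)
    then show "filterlim (\<lambda>n. loglen n - 1 - real (offset t n) * lo_rate n) at_top sequentially"
      by (simp add: algebra_simps)
    show "eventually (\<lambda>n. loglen n - 1 - real (offset t n) * lo_rate n \<le> real (?b n) * lo_rate n) sequentially"
      using ev eventually_rates
    proof eventually_elim
      case (elim n)
      then have "real (maxlen n) = real (?b n) + real (offset t n)" by (metis of_nat_add)
      then show ?case using elim by (simp add: algebra_simps)
    qed
  qed
  then have "(\<lambda>n. exp (- (real (?b n) * lo_rate n))) \<longlonglongrightarrow> 0"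
    by (intro filterlim_compose[OF exp_at_bot]) (simp add: filterlim_uminus_at_bot)
  moreover have "(\<lambda>n. exp (- (real (offset t n) * hi_rate n))) \<longlonglongrightarrow> exp (- (- ln t))"
    by (intro tendsto_exp tendsto_minus offset_rate_limits t)
  ultimately have "(\<lambda>n. exp (- (real (offset t n) * hi_rate n)) * (1 - exp (- (real (?b n) * lo_rate n))))
      \<longlonglongrightarrow> exp (- (- ln t)) * (1 - 0)"
    by (intro tendsto_mult tendsto_diff tendsto_const)
  then show "(\<lambda>n. exp (- (real (offset t n) * hi_rate n)) * (1 - exp (- (real (?b n) * lo_rate n))))
      \<longlonglongrightarrow> t" using t by simp
qed

text \<open>
  The bound \<open>mean_cycles_total_le\<close> is used with \<open>\<delta> = 1 / sqrt L\<close>: then \<open>1 - \<delta>\<close> tends to 1, while the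
  factor \<open>e powr (-sqrt L)\<close> still outweighs the powers of \<open>L\<close>. The harmonic factor \<open>ln m\<close> is
  \<open>O(L)\<close> because \<open>\<alpha>\<close> is at most \<open>n powr a2\<close> with \<open>a2 < 1\<close>.
\<close>

lemma mean_total_limit: "(\<lambda>n. mean_cycles (maxlen n) n (maxlen n) * (\<alpha> n / real n)) \<longlonglongrightarrow> 1"
proof (rule tendsto_sandwich)
  show "eventually (\<lambda>n. \<alpha> n / real (maxlen n) \<le> mean_cycles (maxlen n) n (maxlen n) * (\<alpha> n / real n)) sequentially"
    using eventually_maxlen
  proof eventually_elim
    case (elim n)
    have pos: "\<alpha> n > 0" "real n > 0" using elim alpha_pos[of n] by auto
    have "real n / real (maxlen n) \<le> mean_cycles (maxlen n) n (maxlen n)"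
      using mean_cycles_ge[of "maxlen n" "maxlen n" n] head_mass_total[of "maxlen n" n] elim by simp
    from mult_right_mono[OF this, of "\<alpha> n / real n"] show ?case using pos by simp
  qed
  show "(\<lambda>n. \<alpha> n / real (maxlen n)) \<longlonglongrightarrow> 1" by (rule alpha_over_maxlen)
  \<comment> \<open>\<open>E L\<close> bounds the share of the lengths below \<open>(1 - 1 / sqrt L) m\<close>, in units of \<open>n/\<alpha>\<close>\<close>
  define E where "E x = exp ((1 - 1 / sqrt x) * (x + 1 + ln (5 + 2 * x)) - x) * (1 + x / (1 - a2))" for x
  show "eventually (\<lambda>n. mean_cycles (maxlen n) n (maxlen n) * (\<alpha> n / real n)
     \<le> \<alpha> n / real (maxlen n) * (1 / (1 - 1 / sqrt (loglen n))) + E (loglen n)) sequentially"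
    using eventually_maxlen eventually_rates
      filterlim_at_top_dense[THEN iffD1, OF loglen_at_top, rule_format, of 1]
  proof eventually_elim
    case (elim n)
    let ?m = "maxlen n" and ?x = "loglen n"
    define \<delta> where "\<delta> = 1 / sqrt ?x"
    have \<delta>: "0 \<le> \<delta>" "\<delta> < 1" using elim by (auto simp: \<delta>_def)
    have pos: "\<alpha> n > 0" "real n > 0" using elim alpha_pos[of n] by auto
    have "ln (real ?m) \<le> ln (real n)" using elim by simp
    also have "\<dots> \<le> ?x / (1 - a2)"
      using loglen_bounds(1)[of n] elim a2 by (simp add: field_simps)
    finally have lnm: "1 + ln (real ?m) \<le> 1 + ?x / (1 - a2)" by simp
    have "mean_cycles ?m n ?m \<le> real n / ((1 - \<delta>) * real ?m)
        + exp ((1 - \<delta>) * (real ?m * hi_rate n)) * (1 + ln (real ?m))"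
      using mean_cycles_total_le[of ?m n \<delta>] elim \<delta> by (simp add: hi_rate_def)
    also have "\<dots> \<le> real n / ((1 - \<delta>) * real ?m)
        + exp ((1 - \<delta>) * (?x + 1 + ln (5 + 2 * ?x))) * (1 + ?x / (1 - a2))"
      using elim \<delta> lnm by (intro add_left_mono mult_mono) (auto intro!: mult_left_mono)
    finally have "mean_cycles ?m n ?m * (\<alpha> n / real n)
        \<le> (real n / ((1 - \<delta>) * real ?m)
          + exp ((1 - \<delta>) * (?x + 1 + ln (5 + 2 * ?x))) * (1 + ?x / (1 - a2))) * (\<alpha> n / real n)"
      using pos by (intro mult_right_mono) auto
    also have "\<alpha> n / real n = exp (- ?x)"
      using pos by (simp add: loglen_def exp_minus)
    also have "(N / ((1 - \<delta>) * M) + exp y * C) * exp (- ?x)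
        = N * exp (- ?x) / M * (1 / (1 - \<delta>)) + exp (y - ?x) * C" for N M y C :: real
      by (simp add: distrib_right exp_diff exp_minus divide_inverse)
    also have "exp ((1 - \<delta>) * (?x + 1 + ln (5 + 2 * ?x)) - ?x) * (1 + ?x / (1 - a2)) = E ?x"
      by (simp only: E_def \<delta>_def)
    also have "real n * exp (- ?x) = \<alpha> n"
      using pos by (simp add: loglen_def exp_minus)
    finally show ?case
      using pos by (simp add: \<delta>_def loglen_def exp_minus)
  qed
  have "((\<lambda>x::real. 1 / (1 - 1 / sqrt x)) \<longlongrightarrow> 1) at_top" by real_asymp
  from filterlim_compose[OF this loglen_at_top]
  have 1: "(\<lambda>n. 1 / (1 - 1 / sqrt (loglen n))) \<longlonglongrightarrow> 1" .
  have "(E \<longlongrightarrow> 0) at_top" unfolding E_def using a2 by real_asymp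
  from filterlim_compose[OF this loglen_at_top]
  have 2: "(\<lambda>n. E (loglen n)) \<longlonglongrightarrow> 0" .
  show "(\<lambda>n. \<alpha> n / real (maxlen n) * (1 / (1 - 1 / sqrt (loglen n))) + E (loglen n)) \<longlonglongrightarrow> 1"
    using tendsto_add[OF tendsto_mult[OF alpha_over_maxlen 1] 2] by simp
qed

lemma mean_cycles_limit:
  assumes t: "0 < t" "t \<le> 1"
  shows "(\<lambda>n. mean_cycles (maxlen n) n (maxlen n - offset t n) * (\<alpha> n / real n)) \<longlonglongrightarrow> t"
proof (rule tendsto_sandwich)
  let ?b = "\<lambda>n. maxlen n - offset t n"
  let ?q = "\<lambda>n. \<alpha> n / real (maxlen n) * (head_mass (maxlen n) n (?b n) / real n)"
  have q: "?q \<longlonglongrightarrow> t"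
    using tendsto_mult[OF alpha_over_maxlen head_mass_limit[OF t]] by simp
  then show "?q \<longlonglongrightarrow> t" .
  have "(\<lambda>n. mean_cycles (maxlen n) n (maxlen n) * (\<alpha> n / real n) - \<alpha> n / real (maxlen n) + ?q n)
      \<longlonglongrightarrow> 1 - 1 + t"
    by (intro tendsto_add tendsto_diff mean_total_limit alpha_over_maxlen q)
  then show "(\<lambda>n. mean_cycles (maxlen n) n (maxlen n) * (\<alpha> n / real n) - \<alpha> n / real (maxlen n) + ?q n)
      \<longlonglongrightarrow> t" by simp
  show "eventually (\<lambda>n. ?q n \<le> mean_cycles (maxlen n) n (?b n) * (\<alpha> n / real n)) sequentially"
    using eventually_maxlen
  proof eventually_elim
    case (elim n)
    have pos: "\<alpha> n > 0" "real n > 0" using elim alpha_pos[of n] by auto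
    have "head_mass (maxlen n) n (?b n) / real (maxlen n) \<le> mean_cycles (maxlen n) n (?b n)"
      using elim by (intro mean_cycles_ge) auto
    from mult_right_mono[OF this, of "\<alpha> n / real n"] show ?case using pos by (simp add: mult_ac)
  qed
  show "eventually (\<lambda>n. mean_cycles (maxlen n) n (?b n) * (\<alpha> n / real n)
    \<le> mean_cycles (maxlen n) n (maxlen n) * (\<alpha> n / real n) - \<alpha> n / real (maxlen n) + ?q n) sequentially"
    using eventually_maxlen
  proof eventually_elim
    case (elim n)
    have pos: "\<alpha> n > 0" "real n > 0" using elim alpha_pos[of n] by auto
    have "mean_cycles (maxlen n) n (?b n) \<le> mean_cycles (maxlen n) n (maxlen n)
        - real n / real (maxlen n) + head_mass (maxlen n) n (?b n) / real (maxlen n)"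
      using elim by (intro mean_cycles_le) auto
    from mult_right_mono[OF this, of "\<alpha> n / real n"] show ?case using pos by (simp add: algebra_simps)
  qed
qed

text \<open>
  The mean after division by \<open>n/\<alpha>\<close> tends to \<open>t\<close>, and the variance term after division by
  \<open>(n/\<alpha>)\<^sup>2\<close> is of order \<open>\<alpha>/n\<close>.
\<close>

lemma prob_deviation_limit:
  assumes t: "0 < t" "t \<le> 1" and e: "e > 0"
  shows "(\<lambda>n. measure_pmf.prob (pmf_of_set (short_perms_on (maxlen n) {1..n}))
     {\<sigma>. \<bar>real (cycles_upto (maxlen n - offset t n) {1..n} \<sigma>) / (real n / \<alpha> n) - t\<bar> > e}) \<longlonglongrightarrow> 0"
proof (rule tendsto_sandwich[where f = "\<lambda>_. 0", OF always_eventually _ tendsto_const])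
  let ?\<mu> = "\<lambda>n. mean_cycles (maxlen n) n (maxlen n - offset t n) * (\<alpha> n / real n)"
  show "eventually (\<lambda>n. measure_pmf.prob (pmf_of_set (short_perms_on (maxlen n) {1..n}))
      {\<sigma>. \<bar>real (cycles_upto (maxlen n - offset t n) {1..n} \<sigma>) / (real n / \<alpha> n) - t\<bar> > e}
      \<le> ((?\<mu> n - t)\<^sup>2 + ?\<mu> n * (\<alpha> n / real n)) / e\<^sup>2) sequentially"
    using eventually_maxlen
  proof eventually_elim
    case (elim n)
    let ?m = "maxlen n" and ?b = "maxlen n - offset t n" and ?u = "real n / \<alpha> n"
    have u: "?u > 0" using elim alpha_pos[of n] by simp
    have "\<bar>x / v - t\<bar> > e \<longleftrightarrow> \<bar>x - t * v\<bar> > e * v" if "v > 0" for x v :: real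
    proof -
      have "x - t * v = (x / v - t) * v" using that by (simp add: field_simps)
      then have "\<bar>x - t * v\<bar> = \<bar>x / v - t\<bar> * v" using that by (simp add: abs_mult)
      then show ?thesis using that by simp
    qed
    from this[OF u]
    have "measure_pmf.prob (pmf_of_set (short_perms_on ?m {1..n}))
        {\<sigma>. \<bar>real (cycles_upto ?b {1..n} \<sigma>) / ?u - t\<bar> > e}
      = measure_pmf.prob (pmf_of_set (short_perms_on ?m {1..n}))
        {\<sigma>. \<bar>real (cycles_upto ?b {1..n} \<sigma>) - t * ?u\<bar> > e * ?u}"
      by (simp only:)
    also have "\<dots> \<le> ((mean_cycles ?m n ?b - t * ?u)\<^sup>2 + mean_cycles ?m n ?b) / (e * ?u)\<^sup>2"
      proof -
      have "0 < e * ?u" "?b \<le> n" using mult_pos_pos[OF e u] elim by auto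
      then show ?thesis
        using prob_cycles_upto_deviation_le[of ?m "{1..n}" ?b "e * ?u" "t * ?u"] elim
        by simp
    qed
    also have "\<dots> = ((?\<mu> n - t)\<^sup>2 + ?\<mu> n * (\<alpha> n / real n)) / e\<^sup>2"
    proof -
      have "mean_cycles ?m n ?b = ?\<mu> n * ?u" "\<alpha> n / real n = 1 / ?u" using u by auto
      moreover have "((x * v - t * v)\<^sup>2 + x * v) / (e * v)\<^sup>2 = ((x - t)\<^sup>2 + x * (1 / v)) / e\<^sup>2"
        if "v > 0" for x v :: real
      proof -
        have "(x * v - t * v)\<^sup>2 + x * v = ((x - t)\<^sup>2 + x * (1 / v)) * v\<^sup>2"
          using that by (simp add: power2_eq_square algebra_simps)
        then show ?thesis using that by (simp add: power_mult_distrib)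
      qed
      ultimately show ?thesis using u by metis
    qed
    finally show ?case .
  qed
  have "(\<lambda>n. ((?\<mu> n - t)\<^sup>2 + ?\<mu> n * (\<alpha> n / real n)) / e\<^sup>2) \<longlonglongrightarrow> ((t - t)\<^sup>2 + t * 0) / e\<^sup>2"
    using e by (intro tendsto_intros mean_cycles_limit t inverse_quotient) auto
  then show "(\<lambda>n. ((?\<mu> n - t)\<^sup>2 + ?\<mu> n * (\<alpha> n / real n)) / e\<^sup>2) \<longlonglongrightarrow> 0" by simp
qed simp

end

section \<open>Uniformity in the threshold\<close>

lemma cum_cycle_count_eq:
  assumes \<sigma>: "\<sigma> permutes {1..n}"
  shows "cum_cycle_count n x \<sigma> = cycles_upto (nat \<lfloor>x\<rfloor>) {1..n} \<sigma>"
proof -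
  let ?b = "nat \<lfloor>x\<rfloor>" and ?C = "cycles_on {1..n} \<sigma>"
  have pos: "card c \<ge> 1" if "c \<in> ?C" for c
    using cyclic_on_cycle[OF _ \<sigma> that] finite_subset[of c "{1..n}"]
    by (simp add: Suc_le_eq card_gt_0_iff)
  have "1 \<le> j \<and> real j \<le> x \<longleftrightarrow> j \<in> {1..?b}" for j :: nat
    by (simp add: le_nat_iff le_floor_iff) linarith
  then have "{j. 1 \<le> j \<and> real j \<le> x} = {1..?b}" by blast
  then have "cum_cycle_count n x \<sigma> = (\<Sum>j=1..?b. card {c \<in> ?C. card c = j})"
    by (simp add: cum_cycle_count_def cycle_count_def perm_cycles_def)
  also have "\<dots> = (\<Sum>j=1..?b. \<Sum>c | c \<in> {c \<in> ?C. card c \<le> ?b} \<and> card c = j. 1)"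
    by (intro sum.cong refl) (auto intro: arg_cong[where f = card])
  also have "\<dots> = (\<Sum>c | c \<in> ?C \<and> card c \<le> ?b. 1)"
    by (rule sum.group) (use pos in auto)
  finally show ?thesis by (simp add: cycles_upto_def)
qed

lemma short_perms_eq:
  assumes "\<alpha> n \<ge> 0"
  shows "short_perms \<alpha> n = short_perms_on (nat \<lfloor>\<alpha> n\<rfloor>) {1..n}"
proof -
  have "real k \<le> \<alpha> n \<longleftrightarrow> k \<le> nat \<lfloor>\<alpha> n\<rfloor>" for k
    using assms by (simp add: le_nat_iff le_floor_iff)
  then show ?thesis by (simp add: short_perms_def short_perms_on_def perm_cycles_def)
qed

lemma cycle_threshold_mono:
  assumes "0 \<le> s" "s \<le> t" "\<alpha> n > 0" "ln (real n / \<alpha> n) > 0"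
  shows "cycle_threshold \<alpha> s n \<le> cycle_threshold \<alpha> t n"
proof (cases "s = 0")
  case False
  then have "ln s \<le> ln t" using assms by simp
  then have "\<lfloor>ln s * (\<alpha> n / ln (real n / \<alpha> n))\<rfloor> \<le> \<lfloor>ln t * (\<alpha> n / ln (real n / \<alpha> n))\<rfloor>"
    using assms by (intro floor_mono mult_right_mono) auto
  then show ?thesis using False assms by (auto simp: cycle_threshold_def)
qed (simp add: cycle_threshold_def)

lemma cum_cycle_count_mono:
  assumes "x \<le> y"
  shows "cum_cycle_count n x \<sigma> \<le> cum_cycle_count n y \<sigma>"
proof -
  have "finite {j. 1 \<le> j \<and> real j \<le> y}"
    by (rule finite_subset[of _ "{..nat \<lfloor>y\<rfloor>}"]) (auto simp: le_nat_floor)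
  then show ?thesis unfolding cum_cycle_count_def using assms by (intro sum_mono2) auto
qed

text \<open>
  Between neighbouring grid points a monotone function is squeezed by its values there, which
  costs at most the mesh \<open>1/N\<close>.
\<close>

lemma sup_deviation_le_of_grid:
  fixes F :: "real \<Rightarrow> real"
  assumes mono: "\<And>s t. 0 \<le> s \<Longrightarrow> s \<le> t \<Longrightarrow> t \<le> 1 \<Longrightarrow> F s \<le> F t"
    and N: "N > 0" and grid: "\<And>i. i \<le> N \<Longrightarrow> \<bar>F (real i / real N) - real i / real N\<bar> \<le> \<delta>"
  shows "(SUP t\<in>{0..1}. \<bar>F t - t\<bar>) \<le> \<delta> + 1 / real N"
proof (rule cSUP_least)
  fix t :: real assume t: "t \<in> {0..1}"
  show "\<bar>F t - t\<bar> \<le> \<delta> + 1 / real N"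
  proof (cases "t = 1")
    case True
    then show ?thesis using grid[of N] N by (simp add: add_increasing2)
  next
    case False
    define i where "i = nat \<lfloor>t * real N\<rfloor>"
    have tN: "0 \<le> t * real N" "t * real N < real N" using t False N by auto
    then have i: "real i \<le> t * real N" "t * real N < real i + 1"
      by (auto simp: i_def)
    then have iN: "i < N" using tN by linarith
    have le: "real i / real N \<le> t" "t \<le> real (Suc i) / real N" "real (Suc i) / real N \<le> 1"
      using i iN N by (auto simp: field_simps)
    have eq: "real (Suc i) / real N = real i / real N + 1 / real N" by (simp add: add_divide_distrib)
    have "F (real i / real N) \<le> F t" "F t \<le> F (real (Suc i) / real N)"
      using t le by (auto intro: mono)
    then show ?thesis using grid[of i] grid[of "Suc i"] iN le unfolding eq abs_le_iff by linarith
  qed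
qed auto

context cycle_length_bound
begin

text \<open>
  The offset is an integer, so rounding \<open>\<alpha> n\<close> down commutes with subtracting it; the truncated
  subtraction of natural numbers matches the cut-off at 0.
\<close>

lemma threshold_offset:
  assumes "0 < t" "t \<le> 1" "n \<ge> 1" "loglen n > 0"
  shows "nat \<lfloor>cycle_threshold \<alpha> t n\<rfloor> = maxlen n - offset t n"
proof -
  have "cycle_threshold \<alpha> t n = max (\<alpha> n - real (offset t n)) 0"
    using real_offset[OF assms] assms(1) by (simp add: cycle_threshold_def loglen_def)
  moreover have "\<lfloor>\<alpha> n - real (offset t n)\<rfloor> = \<lfloor>\<alpha> n\<rfloor> - int (offset t n)"
    using floor_diff_of_int[of "\<alpha> n" "int (offset t n)"] by simp
  ultimately show ?thesis
    by (auto simp: maxlen_def max_def nat_diff_distrib' floor_le_iff) linarith+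
qed

lemma sup_deviation_limit:
  assumes e: "e > 0"
  shows "(\<lambda>n. measure_pmf.prob (short_perm_pmf \<alpha> n)
            {\<sigma>. (SUP t\<in>{0..1}.
                   \<bar>real (cum_cycle_count n (cycle_threshold \<alpha> t n) \<sigma>) / (real n / \<alpha> n) - t\<bar>) > e})
         \<longlonglongrightarrow> 0"
proof -
  let ?F = "\<lambda>n \<sigma> t. real (cum_cycle_count n (cycle_threshold \<alpha> t n) \<sigma>) / (real n / \<alpha> n)"
  \<comment> \<open>half of the tolerance is spent on the mesh, half on the deviation at the grid points\<close>
  obtain N :: nat where N: "N > 0" "1 / real N < e / 2"
    using e by (metis half_gt_zero nat_approx_posE zero_less_Suc)
  define B where "B n i = {\<sigma>. \<bar>real (cycles_upto (maxlen n - offset (real i / real N) n) {1..n} \<sigma>)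
      / (real n / \<alpha> n) - real i / real N\<bar> > e / 2}" for n i
  define P where "P n = pmf_of_set (short_perms_on (maxlen n) {1..n})" for n
  have bound: "eventually (\<lambda>n. measure_pmf.prob (short_perm_pmf \<alpha> n) {\<sigma>. (SUP t\<in>{0..1}. \<bar>?F n \<sigma> t - t\<bar>) > e}
      \<le> (\<Sum>i=1..N. measure_pmf.prob (P n) (B n i))) sequentially"
    using eventually_maxlen eventually_loglen_pos
  proof eventually_elim
    case (elim n)
    have pos: "\<alpha> n > 0" using alpha_pos elim by simp
    have P: "short_perm_pmf \<alpha> n = P n"
      using short_perms_eq[of \<alpha> n] pos by (simp add: short_perm_pmf_def P_def maxlen_def)
    have "real (card (short_perms_on (maxlen n) {1..n})) > 0"
      using short_fraction_pos[of "maxlen n" n] elim by (simp add: card_short_perms_on)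
    then have set_P: "set_pmf (P n) = short_perms_on (maxlen n) {1..n}"
      unfolding P_def by (intro set_pmf_of_set) (auto simp: card_gt_0_iff)
    have "{\<sigma>. (SUP t\<in>{0..1}. \<bar>?F n \<sigma> t - t\<bar>) > e} \<inter> set_pmf (P n) \<subseteq> (\<Union>i\<in>{1..N}. B n i)"
    proof (rule subsetI, rule ccontr)
      fix \<sigma> assume \<sigma>: "\<sigma> \<in> {\<sigma>. (SUP t\<in>{0..1}. \<bar>?F n \<sigma> t - t\<bar>) > e} \<inter> set_pmf (P n)"
        and nB: "\<sigma> \<notin> (\<Union>i\<in>{1..N}. B n i)"
      have perm: "\<sigma> permutes {1..n}" using \<sigma> set_P by (simp add: short_perms_on_def)
      have "(SUP t\<in>{0..1}. \<bar>?F n \<sigma> t - t\<bar>) \<le> e / 2 + 1 / real N"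
      proof (rule sup_deviation_le_of_grid[OF _ N(1)])
        show "?F n \<sigma> s \<le> ?F n \<sigma> t" if "0 \<le> s" "s \<le> t" for s t
          using that pos elim
          by (intro divide_right_mono of_nat_mono cum_cycle_count_mono cycle_threshold_mono)
             (auto simp: loglen_def)
        show "\<bar>?F n \<sigma> (real i / real N) - real i / real N\<bar> \<le> e / 2" if "i \<le> N" for i
        proof (cases "i = 0")
          case True
          have no_index: "{j::nat. 1 \<le> j \<and> real j \<le> 0} = {}" by auto
          have "cum_cycle_count n 0 \<sigma> = 0" unfolding cum_cycle_count_def no_index by simp
          then show ?thesis using e by (simp add: True cycle_threshold_def)
        next
          case False
          then have "0 < real i / real N" "real i / real N \<le> 1" using that N by auto
          then have "cum_cycle_count n (cycle_threshold \<alpha> (real i / real N) n) \<sigma>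
              = cycles_upto (maxlen n - offset (real i / real N) n) {1..n} \<sigma>"
            using elim by (simp add: cum_cycle_count_eq[OF perm] threshold_offset)
          moreover have "\<sigma> \<notin> B n i" using nB False that by auto
          ultimately show ?thesis by (simp add: B_def)
        qed
      qed
      then show False using \<sigma> N(2) by simp
    qed
    then have "measure_pmf.prob (P n) ({\<sigma>. (SUP t\<in>{0..1}. \<bar>?F n \<sigma> t - t\<bar>) > e} \<inter> set_pmf (P n))
        \<le> measure_pmf.prob (P n) (\<Union>i\<in>{1..N}. B n i)"
      by (intro measure_pmf.finite_measure_mono) auto
    also have "\<dots> \<le> (\<Sum>i=1..N. measure_pmf.prob (P n) (B n i))"
      by (intro measure_pmf.finite_measure_subadditive_finite) auto
    finally show ?case by (simp only: P measure_Int_set_pmf)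
  qed
  have "(\<lambda>n. \<Sum>i=1..N. measure_pmf.prob (P n) (B n i)) \<longlonglongrightarrow> (\<Sum>i=1..N. 0)"
    unfolding P_def B_def using N e by (intro tendsto_sum prob_deviation_limit) auto
  then have lim: "(\<lambda>n. \<Sum>i=1..N. measure_pmf.prob (P n) (B n i)) \<longlonglongrightarrow> 0" by simp
  show ?thesis
    by (rule tendsto_sandwich[where f = "\<lambda>_. 0", OF always_eventually bound tendsto_const lim]) simp
qed

end

theorem theorem2p5:
  fixes a1 a2 :: real and \<alpha> :: "nat \<Rightarrow> real" and \<epsilon> :: real
  assumes "a1 \<in> {0<..<1}" and "a2 \<in> {0<..<1}"
    and "\<And>n. n \<ge> 1 \<Longrightarrow> real n powr a1 \<le> \<alpha> n \<and> \<alpha> n \<le> real n powr a2"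
    and "\<epsilon> > 0"
  shows "(\<lambda>n. measure_pmf.prob (short_perm_pmf \<alpha> n)
            {\<sigma>. (SUP t\<in>{0..1}.
                   \<bar>real (cum_cycle_count n (cycle_threshold \<alpha> t n) \<sigma>) / (real n / \<alpha> n) - t\<bar>) > \<epsilon>})
         \<longlonglongrightarrow> 0"
proof -
  interpret cycle_length_bound a1 a2 \<alpha>
    using assms(1-3) by unfold_locales auto
  show ?thesis using assms(4) by (rule sup_deviation_limit)
qed

end
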